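(* There is a query algorithm $\mathsf{QueryMaxAg}$ in the SSAC framework that behaves as follows: on input $\varepsilon, \delta > 0$, an integer $k$, and a labelling $\mathcal{L}$ of the edges of a complete graph $G$ on $n$ vertices, with probability at least $1-\delta$ it outputs a clustering of $G$ into at most $k$ clusters whose number of agreements is at least $OPT-\varepsilon n^2/2$, where $OPT$ is the maximum number of agreements induced by any clustering of $G$ into at most $k$ clusters. Its running time is $O\left( \frac{nk}{\varepsilon^3} \log{\frac{k}{\varepsilon^2 \delta}}\right)$ and it makes $O\left( \frac{k}{\varepsilon^3} \log{\frac{k}{\varepsilon^2 \delta}}\right)$ same-cluster queries.
   Context: Correlation clustering: the input is a complete graph $G$ on $n$ vertices with each edge labeled positive or negative (the labelling $\mathcal{L}$). For a clustering (partition) of the vertices, agreements are the positive edges with both endpoints in the same cluster plus the negative edges with endpoints in different clusters. $\mathsf{MaxAgree}[k]$ asks for a clustering into at most $k$ clusters maximising agreements. SSAC framework: the algorithm may query an oracle which, given two vertices $u,v$, answers whether $u$ and $v$ lie in the same cluster of a fixed optimal clustering (all answers consistent with one fixed optimal clustering into at most $k$ clusters); each such call is a same-cluster query.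
   Formalization: The running-time and query bounds are stated for ε ≤ 1 and k/(ε²δ) ≥ 2 only: otherwise the printed bound can be zero or negative (e.g. k = ε = δ = 1) or tend to 0 as ε grows. The success guarantee covers all ε, δ > 0 and k, n ≥ 1. *)

theory Defs
  imports "HOL-Probability.Probability" "HOL-Library.Disjoint_Sets"
begin

section \<open>Correlation clustering\<close>

definition edges :: "nat \<Rightarrow> nat set set" where
  "edges n = {e. e \<subseteq> {..<n} \<and> card e = 2}"

(* A labelling maps an edge to True iff the edge is positive; only its values on edges n matter. *)
type_synonym labelling = "nat set \<Rightarrow> bool"

definition clustering :: "nat \<Rightarrow> nat \<Rightarrow> nat set set \<Rightarrow> bool" where
  "clustering n k P \<longleftrightarrow> partition_on {..<n} P \<and> card P \<le> k"

definition same_cluster :: "nat set set \<Rightarrow> nat \<Rightarrow> nat \<Rightarrow> bool" where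
  "same_cluster P u v \<longleftrightarrow> (\<exists>A\<in>P. u \<in> A \<and> v \<in> A)"

definition agreements :: "nat \<Rightarrow> labelling \<Rightarrow> nat set set \<Rightarrow> nat" where
  "agreements n L P =
     card {e \<in> edges n. L e \<and> (\<exists>A\<in>P. e \<subseteq> A)} +
     card {e \<in> edges n. \<not> L e \<and> \<not> (\<exists>A\<in>P. e \<subseteq> A)}"

definition OPT :: "nat \<Rightarrow> nat \<Rightarrow> labelling \<Rightarrow> nat" where
  "OPT n k L = Max (agreements n L ` {P. clustering n k P})"

definition optimal_clustering :: "nat \<Rightarrow> nat \<Rightarrow> labelling \<Rightarrow> nat set set \<Rightarrow> bool" where
  "optimal_clustering n k L P \<longleftrightarrow> clustering n k P \<and> agreements n L P = OPT n k L"


section \<open>Randomised query programs\<close>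

text \<open>
  Programs run on a random access machine with natural number variables, natural number arrays
  and real variables. Naturals admit only addition and truncated subtraction, reals admit field
  operations and comparisons; there is no rounding from reals to naturals, which would allow
  packing unbounded computations into single numbers. Expressions have bounded size in a
  fixed program, so charging one computation step per command determines the running time
  up to a constant factor.
\<close>

type_synonym vname = string

record store =
  nvar :: "vname \<Rightarrow> nat"
  arr :: "vname \<Rightarrow> nat \<Rightarrow> nat"
  rvar :: "vname \<Rightarrow> real"
  queries :: nat  \<comment> \<open>number of same-cluster queries so far; not readable by programs\<close>

datatype nexp =
    Num nat
  | Var vname
  | Elem vname nexp
  | Add nexp nexp
  | Sub nexp nexp

datatype rexp =
    RVar vname
  | OfNat nexp
  | RAdd rexp rexp
  | RSub rexp rexp
  | RMul rexp rexp
  | RDiv rexp rexp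

datatype bexp =
    Less nexp nexp
  | RLess rexp rexp
  | Neg bexp
  | Conj bexp bexp

datatype com =
    Skip
  | Assign vname nexp
  | Store vname nexp nexp
  | RAssign vname rexp
  | Seq com com
  | Cond bexp com com
  | While bexp com
  | Rand vname nexp
  | Label vname nexp nexp
  | SameCluster vname nexp nexp

primrec nval :: "nexp \<Rightarrow> store \<Rightarrow> nat" where
  "nval (Num i) s = i"
| "nval (Var x) s = nvar s x"
| "nval (Elem A a) s = arr s A (nval a s)"
| "nval (Add a b) s = nval a s + nval b s"
| "nval (Sub a b) s = nval a s - nval b s"

primrec rval :: "rexp \<Rightarrow> store \<Rightarrow> real" where
  "rval (RVar x) s = rvar s x"
| "rval (OfNat a) s = real (nval a s)"
| "rval (RAdd a b) s = rval a s + rval b s"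
| "rval (RSub a b) s = rval a s - rval b s"
| "rval (RMul a b) s = rval a s * rval b s"
| "rval (RDiv a b) s = rval a s / rval b s"

primrec bval :: "bexp \<Rightarrow> store \<Rightarrow> bool" where
  "bval (Less a b) s \<longleftrightarrow> nval a s < nval b s"
| "bval (RLess a b) s \<longleftrightarrow> rval a s < rval b s"
| "bval (Neg b) s \<longleftrightarrow> \<not> bval b s"
| "bval (Conj a b) s \<longleftrightarrow> bval a s \<and> bval b s"

definition set_nvar :: "vname \<Rightarrow> nat \<Rightarrow> store \<Rightarrow> store" where
  "set_nvar x i s = s\<lparr>nvar := (nvar s)(x := i)\<rparr>"

definition set_arr :: "vname \<Rightarrow> nat \<Rightarrow> nat \<Rightarrow> store \<Rightarrow> store" where
  "set_arr A i j s = s\<lparr>arr := (arr s)(A := (arr s A)(i := j))\<rparr>"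

definition set_rvar :: "vname \<Rightarrow> real \<Rightarrow> store \<Rightarrow> store" where
  "set_rvar x r s = s\<lparr>rvar := (rvar s)(x := r)\<rparr>"

text \<open>
  One step of computation. The parameter lab gives access to the edge labels (the input graph),
  and same is the same-cluster oracle. The command Rand x a draws a uniformly random natural
  number below the value of a (and yields 0 if that value is 0).
\<close>

primrec step ::
  "(nat \<Rightarrow> nat \<Rightarrow> bool) \<Rightarrow> (nat \<Rightarrow> nat \<Rightarrow> bool) \<Rightarrow> com \<Rightarrow> store \<Rightarrow> (com \<times> store) pmf" where
  "step lab same Skip s = return_pmf (Skip, s)"
| "step lab same (Assign x a) s = return_pmf (Skip, set_nvar x (nval a s) s)"
| "step lab same (Store A a b) s = return_pmf (Skip, set_arr A (nval a s) (nval b s) s)"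
| "step lab same (RAssign x r) s = return_pmf (Skip, set_rvar x (rval r s) s)"
| "step lab same (Seq c d) s =
     (if c = Skip then return_pmf (d, s)
      else map_pmf (\<lambda>(c', s'). (Seq c' d, s')) (step lab same c s))"
| "step lab same (Cond b c d) s = return_pmf (if bval b s then c else d, s)"
| "step lab same (While b c) s =
     return_pmf (if bval b s then Seq c (While b c) else Skip, s)"
| "step lab same (Rand x a) s =
     map_pmf (\<lambda>i. (Skip, set_nvar x i s)) (pmf_of_set {..<max 1 (nval a s)})"
| "step lab same (Label x a b) s =
     return_pmf (Skip, set_nvar x (of_bool (lab (nval a s) (nval b s))) s)"
| "step lab same (SameCluster x a b) s =
     return_pmf (Skip,
       (set_nvar x (of_bool (same (nval a s) (nval b s))) s)\<lparr>queries := Suc (queries s)\<rparr>)"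

primrec steps ::
  "(nat \<Rightarrow> nat \<Rightarrow> bool) \<Rightarrow> (nat \<Rightarrow> nat \<Rightarrow> bool) \<Rightarrow> nat \<Rightarrow> com \<times> store \<Rightarrow> (com \<times> store) pmf" where
  "steps lab same 0 cs = return_pmf cs"
| "steps lab same (Suc t) cs =
     bind_pmf (step lab same (fst cs) (snd cs)) (steps lab same t)"


section \<open>Running a program on a clustering instance\<close>

definition init_store :: "real \<Rightarrow> real \<Rightarrow> nat \<Rightarrow> nat \<Rightarrow> store" where
  "init_store \<epsilon> \<delta> k n =
     \<lparr>nvar = (\<lambda>_. 0)(''k'' := k, ''n'' := n), arr = (\<lambda>_ _. 0),
      rvar = (\<lambda>_. 0)(''eps'' := \<epsilon>, ''delta'' := \<delta>), queries = 0\<rparr>"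

(* The configuration distribution after t steps on input eps, delta, k, L
   (on the vertex set {..<n}), with oracle answers according to the clustering D. *)
definition execution ::
  "com \<Rightarrow> real \<Rightarrow> real \<Rightarrow> nat \<Rightarrow> nat \<Rightarrow> labelling \<Rightarrow> nat set set \<Rightarrow> nat \<Rightarrow> (com \<times> store) pmf" where
  "execution Q \<epsilon> \<delta> k n L D t =
     steps (\<lambda>u v. {u, v} \<in> edges n \<and> L {u, v}) (same_cluster D) t (Q, init_store \<epsilon> \<delta> k n)"

definition halted :: "com \<times> store \<Rightarrow> bool" where
  "halted cs \<longleftrightarrow> fst cs = Skip"

(* The output is read off the array ''out'': two vertices are clustered together
   iff they carry the same entry. *)
definition out_clustering :: "nat \<Rightarrow> com \<times> store \<Rightarrow> nat set set" where
  "out_clustering n cs =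
     (\<lambda>v. {u \<in> {..<n}. arr (snd cs) ''out'' u = arr (snd cs) ''out'' v}) ` {..<n}"

end

theory Submission
  imports Defs
begin

text \<open>
  Start from the colouring given by the optimal clustering and recolour the vertices one by one.
  Recolouring \<open>v\<close> changes the number of agreements by the difference of two affinities, the
  affinity of \<open>v\<close> to a colour being the signed number of edges from \<open>v\<close> into that colour class of
  the current hybrid colouring. Each vertex greedily takes the colour of the largest affinity, as
  estimated on a random sample. The sample and the hybrid colouring used for it are renewed only
  after about \<open>\<epsilon> n / 16\<close> vertices: within such a block the hybrid changes in few places, and so few
  blocks need few queries. Sample points that are already recoloured have a known colour, and the
  cluster of the others is found by comparing them with one representative of each known cluster.

  By Hoeffding's inequality a vertex is badly estimated with probability at most
  \<open>\<delta> \<epsilon> / 16\<close>, so by Markov's inequality fewer than \<open>\<epsilon> n / 16\<close> vertices are bad with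
  probability at least \<open>1 - \<delta>\<close>. A good vertex loses at most \<open>6 \<epsilon> n / 16\<close> agreements, and a bad
  vertex at most \<open>n\<close>.
\<close>

section \<open>Reasoning about programs\<close>

text \<open>All sample points are drawn before any vertex is queried or coloured, so the rest of the
  run is a deterministic function of one uniform sequence \<open>S\<close>, and probability enters
  only through statements about \<open>S\<close>. Samples have to be renewed because an estimate is
  reliable only for sets fixed independently of the sample, while the hybrid colouring depends on
  all samples used so far. Testing against the hybrid at the start of the block restores
  independence, at the price of a drift within the block. A second dependence comes from the
  numbering of the clusters, which follows the order of their discovery. It is removed by comparing,
  for each \<open>S\<close> separately, with a colouring of the optimal clustering relabelled to
  agree with this numbering. The loss 6 \<epsilon> n / 16 consists of two estimates with error 2
  \<epsilon> n / 16 each and a drift of 2 \<epsilon> n / 16; with the bad vertices the total is 7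
  \<epsilon> n^2 / 16, below the permitted \<epsilon> n^2 / 2.\<close>

notation Seq (infixr ";;" 60)

primrec straight :: "com \<Rightarrow> bool" where
  "straight Skip \<longleftrightarrow> True"
| "straight (Assign x a) \<longleftrightarrow> True"
| "straight (Store A a b) \<longleftrightarrow> True"
| "straight (RAssign x r) \<longleftrightarrow> True"
| "straight (c ;; d) \<longleftrightarrow> straight c \<and> straight d"
| "straight (Cond b c d) \<longleftrightarrow> straight c \<and> straight d"
| "straight (While b c) \<longleftrightarrow> False"
| "straight (Rand x a) \<longleftrightarrow> False"
| "straight (Label x a b) \<longleftrightarrow> True"
| "straight (SameCluster x a b) \<longleftrightarrow> True"

text \<open>An upper bound on the number of steps. The unit added for a sequence pays for the step
  from \<open>Skip ;; d\<close> to \<open>d\<close>.\<close>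

primrec duration :: "com \<Rightarrow> nat" where
  "duration Skip = 1"
| "duration (Assign x a) = 1"
| "duration (Store A a b) = 1"
| "duration (RAssign x r) = 1"
| "duration (c ;; d) = duration c + 1 + duration d"
| "duration (Cond b c d) = 1 + max (duration c) (duration d)"
| "duration (While b c) = 1"
| "duration (Rand x a) = 1"
| "duration (Label x a b) = 1"
| "duration (SameCluster x a b) = 1"

locale oracles =
  fixes lab same :: "nat \<Rightarrow> nat \<Rightarrow> bool"
begin

text \<open>Junk on While and Rand: only meaningful for straight commands, as is \<^const>\<open>duration\<close>.\<close>

primrec exec :: "com \<Rightarrow> store \<Rightarrow> store" where
  "exec Skip s = s"
| "exec (Assign x a) s = set_nvar x (nval a s) s"
| "exec (Store A a b) s = set_arr A (nval a s) (nval b s) s"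
| "exec (RAssign x r) s = set_rvar x (rval r s) s"
| "exec (c ;; d) s = exec d (exec c s)"
| "exec (Cond b c d) s = (if bval b s then exec c s else exec d s)"
| "exec (While b c) s = s"
| "exec (Rand x a) s = s"
| "exec (Label x a b) s = set_nvar x (of_bool (lab (nval a s) (nval b s))) s"
| "exec (SameCluster x a b) s =
     (set_nvar x (of_bool (same (nval a s) (nval b s))) s)\<lparr>queries := Suc (queries s)\<rparr>"

text \<open>\<open>Skip\<close> is absorbing under \<open>step\<close>, so \<open>t\<close> is a
  worst-case bound that may be padded: every run has reached \<open>Skip\<close> by then, and
  \<open>M\<close> is the law of the final store.\<close>

definition halts_with :: "com \<Rightarrow> store \<Rightarrow> nat \<Rightarrow> store pmf \<Rightarrow> bool" where
  "halts_with c s t M \<longleftrightarrow> steps lab same t (c, s) = map_pmf (Pair Skip) M"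

text \<open>Forgets the law and keeps a property of all possible final stores. This suffices for
  every phase of the program except the drawing of the samples.\<close>

definition runs :: "com \<Rightarrow> store \<Rightarrow> nat \<Rightarrow> (store \<Rightarrow> bool) \<Rightarrow> bool" where
  "runs c s t Q \<longleftrightarrow> (\<exists>M. halts_with c s t M \<and> (\<forall>s'\<in>set_pmf M. Q s'))"

lemma steps_Skip: "steps lab same t (Skip, s) = return_pmf (Skip, s)"
  by (induction t) (auto simp: bind_return_pmf)

lemma halts_with_Skip: "halts_with Skip s t (return_pmf s)"
  by (simp add: halts_with_def steps_Skip)

lemma steps_add: "steps lab same (a + b) cs = bind_pmf (steps lab same a cs) (steps lab same b)"
proof (induction a arbitrary: cs)
  case (Suc a)
  have "steps lab same (a + b) = (\<lambda>cs. bind_pmf (steps lab same a cs) (steps lab same b))"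
    using Suc by blast
  then show ?case by (simp add: bind_assoc_pmf)
qed (simp add: bind_return_pmf)

lemma halts_with_mono:
  assumes "halts_with c s t M" "t \<le> t'"
  shows "halts_with c s t' M"
proof -
  obtain d where d: "t' = t + d" using assms(2) le_Suc_ex by blast
  have "steps lab same t' (c, s) = bind_pmf (map_pmf (Pair Skip) M) (steps lab same d)"
    using assms(1) by (simp add: halts_with_def d steps_add)
  then show ?thesis
    unfolding halts_with_def bind_map_pmf steps_Skip by (simp add: map_pmf_def)
qed

lemma halts_with_unique: "halts_with c s t M \<Longrightarrow> halts_with c s t M' \<Longrightarrow> M = M'"
  using pmf.inj_map[of "Pair Skip :: store \<Rightarrow> _"] by (auto simp: halts_with_def inj_def)

text \<open>Halting can be read off the support, because the law of the final store is then the
  second marginal of the law of configurations.\<close>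

lemma halts_with_iff_support:
  "(\<exists>M. halts_with c s t M) \<longleftrightarrow> (\<forall>cs\<in>set_pmf (steps lab same t (c, s)). fst cs = Skip)"
proof
  assume R: "\<forall>cs\<in>set_pmf (steps lab same t (c, s)). fst cs = Skip"
  have "map_pmf (Pair Skip) (map_pmf snd (steps lab same t (c, s)))
      = map_pmf (\<lambda>cs. cs) (steps lab same t (c, s))"
    unfolding pmf.map_comp o_def using R by (intro map_pmf_cong refl) (metis prod.collapse)
  then show "\<exists>M. halts_with c s t M"
    unfolding halts_with_def by (metis map_pmf_ident)
qed (auto simp: halts_with_def)

text \<open>The extra step replaces \<open>Skip ;; d\<close> by \<open>d\<close>. The first step of
  \<open>c\<close> leads to a random configuration; the induction hypothesis applies to each one,
  and the results are mixed over the law \<open>P\<close> of that step.\<close>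

lemma halts_with_Seq:
  assumes "halts_with c s t M" "\<And>s'. s' \<in> set_pmf M \<Longrightarrow> halts_with d s' t' (N s')"
  shows "halts_with (c ;; d) s (t + 1 + t') (bind_pmf M N)"
  using assms
proof (induction t arbitrary: c s M)
  case 0
  then have "return_pmf (c, s) = map_pmf (Pair Skip) M"
    by (simp add: halts_with_def)
  then have "set_pmf (return_pmf (c, s)) = Pair Skip ` set_pmf M" by simp
  then have c: "c = Skip" by auto
  with 0(1) have "M = return_pmf s" using halts_with_Skip halts_with_unique by blast
  then show ?case using 0(2)[of s] by (simp add: c halts_with_def bind_return_pmf)
next
  case (Suc t)
  show ?case
  proof (cases "c = Skip")
    case True
    with Suc.prems(1) have M: "M = return_pmf s"
      using halts_with_Skip halts_with_unique by metis
    with Suc.prems(2)[of s] have "halts_with d s t' (N s)" by simp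
    then have "halts_with d s (t + 1 + t') (N s)" by (rule halts_with_mono) simp
    then show ?thesis by (simp add: True M halts_with_def bind_return_pmf)
  next
    case False
    define P where "P = step lab same c s"
    \<comment> \<open>The law of the final store when the configuration after one step is
      \<open>cs\<close>; \<open>M\<close> is the mixture of these laws over
      \<open>P\<close>.\<close>
    define M1 where "M1 = (\<lambda>cs. map_pmf snd (steps lab same t cs))"
    have eq: "map_pmf (Pair Skip) M = bind_pmf P (steps lab same t)"
      using Suc.prems(1) by (simp add: halts_with_def P_def)
    have h: "halts_with (fst cs) (snd cs) t (M1 cs)" if "cs \<in> set_pmf P" for cs
    proof -
      have "\<forall>x\<in>set_pmf (steps lab same t (fst cs, snd cs)). fst x = Skip"
      proof
        fix x assume "x \<in> set_pmf (steps lab same t (fst cs, snd cs))"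
        then have "x \<in> set_pmf (bind_pmf P (steps lab same t))" using that by auto
        then show "fst x = Skip" unfolding eq[symmetric] by auto
      qed
      then obtain M' where M': "halts_with (fst cs) (snd cs) t M'"
        using halts_with_iff_support by metis
      moreover from M' have "M1 cs = M'"
        by (simp add: halts_with_def M1_def pmf.map_comp o_def)
      ultimately show ?thesis by simp
    qed
    have "map_pmf snd (map_pmf (Pair Skip) M) = map_pmf snd (bind_pmf P (steps lab same t))"
      by (simp add: eq)
    then have M: "M = bind_pmf P M1"
      by (simp add: pmf.map_comp o_def map_bind_pmf M1_def)
    have "steps lab same (Suc t + 1 + t') (c ;; d, s)
        = bind_pmf P (\<lambda>cs. steps lab same (t + 1 + t') (fst cs ;; d, snd cs))"
      using False by (simp add: P_def bind_map_pmf case_prod_unfold)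
    also have "\<dots> = bind_pmf P (\<lambda>cs. map_pmf (Pair Skip) (bind_pmf (M1 cs) N))"
    proof (intro bind_pmf_cong refl)
      fix cs assume cs: "cs \<in> set_pmf P"
      have "halts_with (fst cs ;; d) (snd cs) (t + 1 + t') (bind_pmf (M1 cs) N)"
      proof (rule Suc.IH[OF h[OF cs]])
        fix s' assume "s' \<in> set_pmf (M1 cs)"
        then have "s' \<in> set_pmf M" using cs by (auto simp: M)
        then show "halts_with d s' t' (N s')" by (rule Suc.prems(2))
      qed
      then show "steps lab same (t + 1 + t') (fst cs ;; d, snd cs)
          = map_pmf (Pair Skip) (bind_pmf (M1 cs) N)"
        by (simp add: halts_with_def)
    qed
    also have "\<dots> = map_pmf (Pair Skip) (bind_pmf M N)"
      by (simp add: M bind_assoc_pmf map_bind_pmf)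
    finally show ?thesis by (simp add: halts_with_def)
  qed
qed

lemma halts_with_While:
  assumes "bval b s" "halts_with (c ;; While b c) s t M"
  shows "halts_with (While b c) s (Suc t) M"
  using assms by (simp add: halts_with_def bind_return_pmf)

lemma halts_with_While_end:
  assumes "\<not> bval b s"
  shows "halts_with (While b c) s (Suc t) (return_pmf s)"
  using assms by (simp add: halts_with_def bind_return_pmf steps_Skip)

lemma halts_with_straight: "straight c \<Longrightarrow> halts_with c s (duration c) (return_pmf (exec c s))"
proof (induction c arbitrary: s)
  case (Seq c d)
  then show ?case
    using halts_with_Seq[of c s "duration c" "return_pmf (exec c s)" d "duration d" "\<lambda>s'. return_pmf (exec d s')"]
    by (simp add: bind_return_pmf)
next
  case (Cond b c d)
  have "halts_with (if bval b s then c else d) s (max (duration c) (duration d)) (return_pmf (exec (Cond b c d) s))"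
    using Cond by (auto intro: halts_with_mono[OF _ max.cobounded1] halts_with_mono[OF _ max.cobounded2])
  then show ?case by (simp add: halts_with_def bind_return_pmf)
qed (auto simp: halts_with_def bind_return_pmf)

section \<open>Timed rules for properties of all final stores\<close>

lemma runs_weaken:
  assumes "runs c s t Q" "t \<le> t'" "\<And>s'. Q s' \<Longrightarrow> Q' s'"
  shows "runs c s t' Q'"
  using assms unfolding runs_def by (meson halts_with_mono)

lemma runs_straight:
  assumes "straight c" "duration c \<le> t" "Q (exec c s)"
  shows "runs c s t Q"
  unfolding runs_def using halts_with_mono[OF halts_with_straight[OF assms(1)] assms(2)] assms(3) by (metis set_return_pmf singletonD)

lemma runs_Seq:
  assumes "runs c s t1 P" "\<And>s'. P s' \<Longrightarrow> runs d s' t2 Q" "t1 + 1 + t2 \<le> t"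
  shows "runs (c ;; d) s t Q"
proof -
  obtain M where M: "halts_with c s t1 M" "\<And>s'. s' \<in> set_pmf M \<Longrightarrow> P s'"
    using assms(1) by (auto simp: runs_def)
  have "\<forall>s'\<in>set_pmf M. \<exists>N. halts_with d s' t2 N \<and> (\<forall>s''\<in>set_pmf N. Q s'')"
    using M(2) assms(2) by (auto simp: runs_def)
  then obtain N where N: "\<And>s'. s' \<in> set_pmf M \<Longrightarrow> halts_with d s' t2 (N s')"
    "\<And>s' s''. s' \<in> set_pmf M \<Longrightarrow> s'' \<in> set_pmf (N s') \<Longrightarrow> Q s''"
    by metis
  from halts_with_Seq[OF M(1) N(1)] have "halts_with (c ;; d) s t (bind_pmf M N)"
    using assms(3) halts_with_mono by blast
  moreover have "\<forall>s''\<in>set_pmf (bind_pmf M N). Q s''" using N(2) by auto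
  ultimately show ?thesis unfolding runs_def by blast
qed

text \<open>An iteration costs two steps beyond its body, one to unfold the loop and one to discard
  the \<open>Skip\<close> left by the body; the last unit pays for the failing test.\<close>

lemma runs_While:
  assumes "I s"
    and body: "\<And>s. I s \<Longrightarrow> bval b s \<Longrightarrow> runs c s tc (\<lambda>s'. I s' \<and> f s' < (f s :: nat))"
    and "f s * (tc + 2) + 1 \<le> t"
  shows "runs (While b c) s t (\<lambda>s'. I s' \<and> \<not> bval b s')"
proof -
  have "runs (While b c) s (f s * (tc + 2) + 1) (\<lambda>s'. I s' \<and> \<not> bval b s')"
    using assms(1)
  proof (induction "f s" arbitrary: s rule: less_induct)
    case less
    show ?case
    proof (cases "bval b s")
      case True
      have "runs (c ;; While b c) s (f s * (tc + 2)) (\<lambda>s'. I s' \<and> \<not> bval b s')"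
      proof (rule runs_Seq[OF body[OF less.prems True]])
        fix s' assume s': "I s' \<and> f s' < f s"
        show "runs (While b c) s' ((f s - 1) * (tc + 2) + 1) (\<lambda>s'. I s' \<and> \<not> bval b s')"
        proof (rule runs_weaken)
          show "runs (While b c) s' (f s' * (tc + 2) + 1) (\<lambda>s'. I s' \<and> \<not> bval b s')"
            using less.hyps s' by blast
          have "f s' \<le> f s - 1" using s' by linarith
          then show "f s' * (tc + 2) + 1 \<le> (f s - 1) * (tc + 2) + 1"
            by (meson add_le_mono1 mult_le_mono1)
        qed
      next
        show "tc + 1 + ((f s - 1) * (tc + 2) + 1) \<le> f s * (tc + 2)"
        proof (cases "f s")
          \<comment> \<open>Impossible: the body has at least one final store, and \<open>f\<close>
            would have to be negative there.\<close>
          case 0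
          then show ?thesis
            using body[OF less.prems True] by (auto simp: runs_def set_pmf_not_empty)
        qed simp
      qed
      then show ?thesis
        unfolding runs_def using halts_with_While[OF True] by (metis Suc_eq_plus1)
    next
      case False
      then show ?thesis
        unfolding runs_def using halts_with_While_end[OF False] less.prems
        by (metis Suc_eq_plus1 set_return_pmf singletonD)
    qed
  qed
  then show ?thesis using assms(3) by (rule runs_weaken) simp
qed

text \<open>The iteration index lives in the invariant and replaces a variant. This serves the loops
  whose number of rounds is fixed in advance.\<close>

lemma runs_for:
  assumes init: "I 0 s"
    and body: "\<And>i s. i < N \<Longrightarrow> I i s \<Longrightarrow> bval b s \<and> runs c s tc (I (Suc i))"
    and exit: "\<And>s. I N s \<Longrightarrow> \<not> bval b s"
    and t: "N * (tc + 2) + 1 \<le> t"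
  shows "runs (While b c) s t (I N)"
proof -
  have "runs (While b c) s ((N - i) * (tc + 2) + 1) (I N)" if "i \<le> N" "I i s" for i s
    using that
  proof (induction i arbitrary: s rule: inc_induct)
    case base
    then show ?case
      unfolding runs_def using halts_with_While_end[OF exit]
      by (metis Suc_eq_plus1 set_return_pmf singletonD)
  next
    case (step i)
    have "runs (c ;; While b c) s ((N - i) * (tc + 2)) (I N)"
    proof (rule runs_Seq)
      show "runs c s tc (I (Suc i))" using body step by blast
      show "tc + 1 + ((N - Suc i) * (tc + 2) + 1) \<le> (N - i) * (tc + 2)"
        unfolding Suc_diff_Suc[OF step.hyps(2), symmetric] mult_Suc by simp
    qed (rule step.IH)
    then show ?case
      unfolding runs_def using halts_with_While body step by (metis Suc_eq_plus1)
  qed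
  from runs_weaken[OF this[OF _ init]] show ?thesis using t by simp
qed

end


section \<open>Agreements of colourings\<close>

definition monochromatic :: "(nat \<Rightarrow> nat) \<Rightarrow> nat set \<Rightarrow> bool" where
  "monochromatic h e \<longleftrightarrow> (\<forall>u\<in>e. \<forall>v\<in>e. h u = h v)"

definition colour_agreements :: "nat \<Rightarrow> labelling \<Rightarrow> (nat \<Rightarrow> nat) \<Rightarrow> real" where
  "colour_agreements n L h = (\<Sum>e\<in>edges n. of_bool (L e = monochromatic h e))"

text \<open>The value 0 on the diagonal makes the affinities of \<open>v\<close> independent of the
  current colour of \<open>v\<close> itself.\<close>

definition sign_label :: "(nat \<Rightarrow> nat \<Rightarrow> bool) \<Rightarrow> nat \<Rightarrow> nat \<Rightarrow> real" where
  "sign_label lab v u = (if u = v then 0 else if lab v u then 1 else - 1)"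

definition affinity :: "(nat \<Rightarrow> nat \<Rightarrow> bool) \<Rightarrow> nat \<Rightarrow> (nat \<Rightarrow> nat) \<Rightarrow> nat \<Rightarrow> nat \<Rightarrow> real" where
  "affinity lab n h v j = (\<Sum>u<n. if h u = j then sign_label lab v u else 0)"

definition edge_label :: "nat \<Rightarrow> labelling \<Rightarrow> nat \<Rightarrow> nat \<Rightarrow> bool" where
  "edge_label n L u v \<longleftrightarrow> {u, v} \<in> edges n \<and> L {u, v}"

lemma abs_sign_label_le: "\<bar>sign_label lab v u\<bar> \<le> 1"
  by (simp add: sign_label_def)

lemma finite_edges [simp]: "finite (edges n)"
  by (rule finite_subset[of _ "Pow {..<n}"]) (auto simp: edges_def)

lemma doubleton_in_edges: "{u, v} \<in> edges n \<longleftrightarrow> u < n \<and> v < n \<and> u \<noteq> v"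
  by (auto simp: edges_def card_insert_if)

lemma edges_cases:
  assumes "e \<in> edges n"
  obtains u v where "e = {u, v}" "u < n" "v < n" "u \<noteq> v"
  using assms by (auto simp: edges_def card_2_iff)

lemma monochromatic_doubleton: "monochromatic h {u, v} \<longleftrightarrow> h u = h v"
  by (auto simp: monochromatic_def)

lemma agreements_eq_colour_agreements:
  assumes "\<And>u v. u < n \<Longrightarrow> v < n \<Longrightarrow> h u = h v \<longleftrightarrow> (\<exists>A\<in>P. u \<in> A \<and> v \<in> A)"
  shows "real (agreements n L P) = colour_agreements n L h"
proof -
  have mono: "(\<exists>A\<in>P. e \<subseteq> A) = monochromatic h e" if "e \<in> edges n" for e
    using that by (rule edges_cases) (use assms in \<open>auto simp: monochromatic_doubleton\<close>)
  have "agreements n L P = card {e \<in> edges n. L e \<and> monochromatic h e}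
      + card {e \<in> edges n. \<not> L e \<and> \<not> monochromatic h e}"
    unfolding agreements_def using mono by (intro arg_cong2[of _ _ _ _ "(+)"] arg_cong[of _ _ card]) auto
  also have "\<dots> = card ({e \<in> edges n. L e \<and> monochromatic h e}
      \<union> {e \<in> edges n. \<not> L e \<and> \<not> monochromatic h e})"
    by (rule card_Un_disjoint[symmetric]) auto
  also have "\<dots> = card {e \<in> edges n. L e = monochromatic h e}"
    by (rule arg_cong[of _ _ card]) auto
  finally show ?thesis
    by (simp add: colour_agreements_def sum.If_cases Int_def of_bool_def)
qed

text \<open>For an edge at \<open>v\<close>, the indicator of agreement is the indicator of a
  negative label plus, if both ends share a colour, the sign of the label. Hence only the affinity
  term depends on the colour of \<open>v\<close>.\<close>

lemma colour_agreements_split: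
  assumes "v < n"
  shows "colour_agreements n L h =
      (\<Sum>e | e \<in> edges n \<and> v \<notin> e. of_bool (L e = monochromatic h e))
    + (\<Sum>u\<in>{..<n} - {v}. of_bool (\<not> L {v, u}))
    + affinity (edge_label n L) n h v (h v)"
proof -
  let ?f = "\<lambda>e. of_bool (L e = monochromatic h e) :: real"
  have edges: "edges n = {e \<in> edges n. v \<notin> e} \<union> (\<lambda>u. {v, u}) ` ({..<n} - {v})"
    using assms by (auto elim!: edges_cases simp: doubleton_in_edges)
  have "colour_agreements n L h
      = sum ?f {e \<in> edges n. v \<notin> e} + sum ?f ((\<lambda>u. {v, u}) ` ({..<n} - {v}))"
    unfolding colour_agreements_def by (subst (1) edges, rule sum.union_disjoint) auto
  also have "sum ?f ((\<lambda>u. {v, u}) ` ({..<n} - {v})) = (\<Sum>u\<in>{..<n} - {v}. ?f {v, u})"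
    by (subst sum.reindex) (auto simp: inj_on_def doubleton_eq_iff)
  also have "\<dots> = (\<Sum>u\<in>{..<n} - {v}. of_bool (\<not> L {v, u})
      + (if h u = h v then sign_label (edge_label n L) v u else 0))"
    using assms by (intro sum.cong)
      (auto simp: monochromatic_doubleton sign_label_def edge_label_def doubleton_in_edges)
  also have "\<dots> = (\<Sum>u\<in>{..<n} - {v}. of_bool (\<not> L {v, u}))
      + (\<Sum>u\<in>{..<n} - {v}. if h u = h v then sign_label (edge_label n L) v u else 0)"
    by (rule sum.distrib)
  also have "(\<Sum>u\<in>{..<n} - {v}. if h u = h v then sign_label (edge_label n L) v u else 0)
      = affinity (edge_label n L) n h v (h v)"
    unfolding affinity_def by (intro sum.mono_neutral_left) (auto simp: sign_label_def)
  finally show ?thesis by simp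
qed

lemma colour_agreements_upd:
  assumes "v < n"
  shows "colour_agreements n L (h(v := j)) = colour_agreements n L h
    + affinity (edge_label n L) n h v j - affinity (edge_label n L) n h v (h v)"
proof -
  have "(\<Sum>e | e \<in> edges n \<and> v \<notin> e. of_bool (L e = monochromatic (h(v := j)) e))
      = (\<Sum>e | e \<in> edges n \<and> v \<notin> e. of_bool (L e = monochromatic h e) :: real)"
    by (intro sum.cong refl arg_cong[of _ _ of_bool] arg_cong2[of _ _ _ _ "(=)"])
      (auto simp: monochromatic_def intro!: ball_cong)
  moreover have "affinity (edge_label n L) n (h(v := j)) v j = affinity (edge_label n L) n h v j"
    unfolding affinity_def by (intro sum.cong) (auto simp: sign_label_def)
  ultimately show ?thesis
    using colour_agreements_split[OF assms, of L h]
      colour_agreements_split[OF assms, of L "h(v := j)", unfolded fun_upd_same]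
    by linarith
qed


context
  fixes D :: "nat set set" and n :: nat
  assumes D: "partition_on {..<n} D"
begin

lemma same_cluster_refl: "u < n \<Longrightarrow> same_cluster D u u"
  using D by (auto simp: partition_on_def same_cluster_def)

lemma same_cluster_iff:
  assumes "A \<in> D" "u \<in> A"
  shows "same_cluster D u v \<longleftrightarrow> v \<in> A"
  using D assms by (auto simp: partition_on_def same_cluster_def disjoint_def)

end


section \<open>The greedy algorithm as a function of the sample\<close>

primrec best :: "(nat \<Rightarrow> real) \<Rightarrow> nat \<Rightarrow> nat" where
  "best f 0 = 0"
| "best f (Suc j) = (if j = 0 \<or> f (best f j) < f j then j else best f j)"

lemma best_less: "k \<ge> 1 \<Longrightarrow> best f k < k"
  by (induction k) (auto intro: less_SucI)

lemma best_max: "j < k \<Longrightarrow> f j \<le> f (best f k)"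
proof (induction k)
  case (Suc k)
  show ?case
  proof (cases "j = k")
    case False
    with Suc have "f j \<le> f (best f k)" by simp
    then show ?thesis using False Suc.prems by auto
  qed auto
qed simp

locale greedy = oracles +
  fixes n k s :: nat and \<eta> :: real
begin

text \<open>
  The vertices are processed in blocks of length about \<^term>\<open>\<eta> * n\<close>. The pair consists of the
  first vertex of the current block and of the first index of the sample used for that block.
\<close>

primrec block :: "nat \<Rightarrow> nat \<times> nat" where
  "block 0 = (0, 0)"
| "block (Suc v) =
     (if \<eta> * n < real (Suc v - fst (block v)) then (Suc v, snd (block v) + s) else block v)"

abbreviation "start v \<equiv> fst (block v)"
abbreviation "off v \<equiv> snd (block v)"

text \<open>One sampled vertex for each cluster met so far, in order of discovery; the position in
  the list serves as the colour of the cluster.\<close>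

primrec reps :: "(nat \<Rightarrow> nat) \<Rightarrow> nat \<Rightarrow> nat list" where
  "reps S 0 = []"
| "reps S (Suc t) = (if \<forall>x\<in>set (reps S t). \<not> same (S t) x then reps S t @ [S t] else reps S t)"

text \<open>If no representative matches, the value is the length of the list, which is the position
  at which \<open>S t\<close> is then appended.\<close>

definition name :: "(nat \<Rightarrow> nat) \<Rightarrow> nat \<Rightarrow> nat" where
  "name S t = length (takeWhile (\<lambda>x. \<not> same (S t) x) (reps S t))"

definition sample_colour :: "(nat \<Rightarrow> nat) \<Rightarrow> (nat \<Rightarrow> nat) \<Rightarrow> nat \<Rightarrow> nat \<Rightarrow> nat" where
  "sample_colour S h b t = (if S t < b then h (S t) else name S t)"

definition score :: "(nat \<Rightarrow> nat) \<Rightarrow> (nat \<Rightarrow> nat) \<Rightarrow> nat \<Rightarrow> nat \<Rightarrow> real" where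
  "score S h v j =
     (\<Sum>t\<in>{off v..<off v + s}. if sample_colour S h (start v) t = j then sign_label lab v (S t) else 0)"

primrec out :: "(nat \<Rightarrow> nat) \<Rightarrow> nat \<Rightarrow> nat \<Rightarrow> nat" where
  "out S 0 = (\<lambda>_. 0)"
| "out S (Suc v) = (out S v)(v := best (score S (out S v) v) k)"

lemma start_le: "start v \<le> v"
  by (induction v) auto

lemma diff_start_le: "0 \<le> \<eta> \<Longrightarrow> real (v - start v) \<le> \<eta> * n"
  by (cases v) auto

text \<open>Every completed block is longer than \<open>\<eta> * n\<close>, so at most
  \<open>1 / \<eta>\<close> blocks are completed before a vertex below \<open>n\<close>; the current
  block adds one more sample of size \<open>s\<close>.\<close>

lemma off_bound:
  assumes "\<eta> > 0" "v < n"
  shows "real (off v + s) \<le> (1 / \<eta> + 1) * s"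
proof -
  have "\<exists>i. off v = i * s \<and> i * (\<eta> * n) \<le> start v"
  proof (induction v)
    case (Suc v)
    then obtain i where i: "off v = i * s" "i * (\<eta> * n) \<le> start v" by blast
    show ?case
    proof (cases "\<eta> * n < real (Suc v - start v)")
      case True
      then have "Suc i * (\<eta> * n) \<le> start v + real (Suc v - start v)"
        using i(2) by (simp add: algebra_simps)
      also have "\<dots> = Suc v" using start_le[of v] by simp
      finally show ?thesis using True i(1) by (intro exI[of _ "Suc i"]) auto
    qed (use i in auto)
  qed (auto intro: exI[of _ 0])
  then obtain i where i: "off v = i * s" "i * (\<eta> * n) \<le> start v" by blast
  have "i * (\<eta> * n) \<le> n" using i(2) start_le[of v] assms(2) by linarith
  then have "i * \<eta> * real n \<le> 1 * real n" by (simp add: mult.assoc)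
  then have "i * \<eta> \<le> 1" using assms(2) by (subst (asm) mult_le_cancel_right) auto
  then have "i \<le> 1 / \<eta>" using assms(1) by (simp add: field_simps)
  then have "real (i + 1) * s \<le> (1 / \<eta> + 1) * s" by (intro mult_right_mono) auto
  then show ?thesis by (simp add: i(1) algebra_simps)
qed

lemma off_before_start: "u < start v \<Longrightarrow> off u + s \<le> off v"
proof (induction v)
  case (Suc v)
  have mono: "off u \<le> off v" if "u \<le> v" for u
    using that by (induction v rule: dec_induct) auto
  show ?case using Suc mono[of u] by (auto split: if_splits)
qed simp

lemma out_stable: "u < v \<Longrightarrow> v \<le> w \<Longrightarrow> out S w u = out S v u"
proof (induction w)
  case (Suc w)
  then show ?case by (cases "v = Suc w") auto
qed simp

lemma out_less: "k \<ge> 1 \<Longrightarrow> out S v u < k"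
  by (induction v) (auto simp: best_less)

lemma out_score_max:
  assumes "v < w" "j < k"
  shows "score S (out S v) v j \<le> score S (out S v) v (out S w v)"
  using best_max[OF assms(2), of "score S (out S v) v"] out_stable[of v "Suc v" w S] assms(1) by simp

lemma name_cong:
  assumes "\<And>i. i \<le> t \<Longrightarrow> S i = S' i"
  shows "name S t = name S' t"
proof -
  have "reps S i = reps S' i" if "i \<le> t" for i
    using that assms by (induction i) auto
  then show ?thesis using assms[of t] by (simp add: name_def)
qed

text \<open>This is the source of independence: earlier blocks read only sample points with index
  below \<open>off v\<close>, and the name with index \<open>t\<close> involves only the points up
  to \<open>t\<close>.\<close>

lemma out_start_cong:
  assumes "\<And>t. t < off v \<Longrightarrow> S t = S' t"
  shows "out S (start v) = out S' (start v)"
proof -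
  have "out S w = out S' w" if "w \<le> start v" for w
    using that
  proof (induction w)
    case (Suc w)
    have "S t = S' t" "name S t = name S' t" if "t < off w + s" for t
      using off_before_start[of w v] that Suc.prems by (auto intro!: assms name_cong)
    then have "score S h w = score S' h w" for h
      unfolding score_def sample_colour_def by (intro ext sum.cong refl) auto
    then show ?case using Suc by simp
  qed simp
  then show ?thesis by simp
qed

text \<open>
  A vertex is good if the sample of its block estimates its affinity to each of the test sets
  well. The test sets do not depend on that sample, whereas the colour classes do: a cluster
  first met in the current block is named after sampling it. Hence the already coloured part of
  a colour class and its uncoloured part, a piece of a cluster, are tested separately.
\<close>

definition test_sets :: "nat set set \<Rightarrow> (nat \<Rightarrow> nat) \<Rightarrow> nat \<Rightarrow> nat set set" where
  "test_sets D S v =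
     (\<lambda>j. {u \<in> {..<start v}. out S (start v) u = j}) ` {..<k} \<union> (\<lambda>A. {u \<in> A. start v \<le> u}) ` D"

text \<open>Sample mean against population mean with error below \<open>\<eta>\<close>, multiplied
  by \<open>n * s\<close> to avoid divisions.\<close>

definition accurate :: "(nat \<Rightarrow> nat) \<Rightarrow> nat \<Rightarrow> nat set \<Rightarrow> bool" where
  "accurate S v X \<longleftrightarrow>
     \<bar>n * (\<Sum>t\<in>{off v..<off v + s}. if S t \<in> X then sign_label lab v (S t) else 0)
        - s * (\<Sum>u<n. if u \<in> X then sign_label lab v u else 0)\<bar> < \<eta> * n * s"

definition good :: "nat set set \<Rightarrow> (nat \<Rightarrow> nat) \<Rightarrow> nat \<Rightarrow> bool" where
  "good D S v \<longleftrightarrow> (\<forall>X\<in>test_sets D S v. accurate S v X)"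

lemma accurate_empty: "\<eta> > 0 \<Longrightarrow> n \<ge> 1 \<Longrightarrow> s \<ge> 1 \<Longrightarrow> accurate S v {}"
  by (simp add: accurate_def)

text \<open>Limits the damage done by a bad vertex: a vertex \<open>u\<close> has a single colour
  and so contributes at most 1 in absolute value.\<close>

lemma affinity_diff_ge: "- real n \<le> affinity lab n h v j - affinity lab n h v i"
proof -
  have "- real n = (\<Sum>u<n. - 1)" by simp
  also have "\<dots> \<le> (\<Sum>u<n. (if h u = j then sign_label lab v u else 0)
      - (if h u = i then sign_label lab v u else 0))"
    by (intro sum_mono) (auto simp: sign_label_def)
  finally show ?thesis by (simp add: affinity_def sum_subtractf)
qed

text \<open>Limits the drift within a block: the contribution of one vertex to the difference lies
  between -1 and 1, so recolouring it changes the difference by at most 2.\<close>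

lemma affinity_diff_change:
  assumes "\<And>u. u < n \<Longrightarrow> h u \<noteq> h' u \<Longrightarrow> u \<in> {b..<v}"
  shows "affinity lab n h v j - affinity lab n h v i
    \<ge> affinity lab n h' v j - affinity lab n h' v i - 2 * real (v - b)"
proof -
  let ?d = "\<lambda>h u. (if h u = j then sign_label lab v u else 0) - (if h u = i then sign_label lab v u else 0)"
  have "(\<Sum>u<n. ?d h' u - ?d h u) \<le> (\<Sum>u<n. if u \<in> {b..<v} then 2 else 0)"
    using assms by (intro sum_mono) (auto simp: sign_label_def)
  also have "\<dots> = 2 * real (card ({..<n} \<inter> {b..<v}))" by (simp add: sum.If_cases Int_def)
  also have "\<dots> \<le> 2 * real (card {b..<v})" using card_mono[of "{b..<v}"] by fastforce
  finally show ?thesis by (simp add: affinity_def sum_subtractf)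
qed

definition hybrid :: "(nat \<Rightarrow> nat) \<Rightarrow> (nat \<Rightarrow> nat) \<Rightarrow> nat \<Rightarrow> nat \<Rightarrow> nat" where
  "hybrid S c v u = (if u < v then out S v u else c u)"

lemma hybrid_Suc: "hybrid S c (Suc v) = (hybrid S c v)(v := out S (Suc v) v)"
  by (auto simp: hybrid_def fun_eq_iff less_Suc_eq)

context
  fixes D :: "nat set set" and c S :: "nat \<Rightarrow> nat"
  assumes D: "partition_on {..<n} D"
    and k: "k \<ge> 1" and n: "n \<ge> 1" and s: "s \<ge> 1" and \<eta>: "\<eta> > 0"
    and c_less: "\<And>u. u < n \<Longrightarrow> c u < k"
    and c_eq: "\<And>u v. u < n \<Longrightarrow> v < n \<Longrightarrow> c u = c v \<longleftrightarrow> same_cluster D u v"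
    and S: "\<And>v t. v < n \<Longrightarrow> t < off v + s \<Longrightarrow> S t < n \<and> name S t = c (S t)"
begin

text \<open>A colour of \<open>c\<close> belongs to at most one cluster, so its uncoloured part is a
  test set. The alternative \<open>{}\<close> covers colours that no uncoloured vertex has; the
  empty set is trivially accurate.\<close>

lemma uncoloured_class:
  "{u \<in> {start v..<n}. c u = j} = {} \<or> {u \<in> {start v..<n}. c u = j} \<in> (\<lambda>A. {u \<in> A. start v \<le> u}) ` D"
proof (cases "{u \<in> {start v..<n}. c u = j} = {}")
  case False
  then obtain x where x: "x < n" "c x = j" by auto
  then obtain A where A: "A \<in> D" "x \<in> A"
    using D by (auto simp: partition_on_def)
  have "u \<in> A \<longleftrightarrow> u < n \<and> c u = j" for u
  proof (cases "u < n")
    case True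
    then show ?thesis
      using c_eq[OF x(1) True] same_cluster_iff[OF D A, of u] x(2) by auto
  next
    case False
    then show ?thesis using D A by (auto simp: partition_on_def)
  qed
  then have "{u \<in> {start v..<n}. c u = j} = {u \<in> A. start v \<le> u}" by auto
  then show ?thesis using A by auto
qed simp

text \<open>The class of colour \<open>j\<close> in the hybrid is the disjoint union of its coloured
  part \<open>?X\<close> and its uncoloured part \<open>?Y\<close>. Score and affinity split
  accordingly, and each part contributes an error of \<open>\<eta> * n * s\<close>.\<close>

lemma score_estimate:
  assumes "good D S v" "v < n" "j < k"
  shows "\<bar>n * score S (out S v) v j - s * affinity lab n (hybrid S c (start v)) v j\<bar> \<le> 2 * (\<eta> * n * s)"
proof -
  let ?X = "{u \<in> {..<start v}. out S (start v) u = j}" and ?Y = "{u \<in> {start v..<n}. c u = j}"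
  let ?I = "{off v..<off v + s}" and ?f = "sign_label lab v"
  have "accurate S v ?X" using assms(1,3) by (auto simp: good_def test_sets_def)
  moreover have "accurate S v ?Y"
    using uncoloured_class[of v j]
  proof
    assume "?Y = {}"
    then show ?thesis using accurate_empty[OF \<eta> n s] by metis
  next
    assume "?Y \<in> (\<lambda>A. {u \<in> A. start v \<le> u}) ` D"
    then show ?thesis using assms(1) unfolding good_def test_sets_def by blast
  qed
  moreover have "score S (out S v) v j
      = (\<Sum>t\<in>?I. if S t \<in> ?X then ?f (S t) else 0) + (\<Sum>t\<in>?I. if S t \<in> ?Y then ?f (S t) else 0)"
    \<comment> \<open>Below \<open>start v\<close> the colourings \<open>out S v\<close> and
      \<open>out S (start v)\<close> agree; on the other sampled points the name equals the value of
      \<open>c\<close>.\<close>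
    unfolding score_def sum.distrib[symmetric]
    using S[OF assms(2)] out_stable[of _ "start v" v S] start_le[of v]
    by (intro sum.cong) (auto simp: sample_colour_def)
  moreover have "affinity lab n (hybrid S c (start v)) v j
      = (\<Sum>u<n. if u \<in> ?X then ?f u else 0) + (\<Sum>u<n. if u \<in> ?Y then ?f u else 0)"
    unfolding affinity_def sum.distrib[symmetric] by (intro sum.cong) (auto simp: hybrid_def)
  ultimately show ?thesis by (simp add: accurate_def distrib_left)
qed

lemma good_step:
  assumes "good D S v" "v < n"
  shows "affinity lab n (hybrid S c v) v (out S (Suc v) v) - affinity lab n (hybrid S c v) v (c v)
    \<ge> - (6 * \<eta> * n)"
proof -
  let ?a = "affinity lab n (hybrid S c (start v)) v" and ?j = "out S (Suc v) v"
  have "score S (out S v) v (c v) \<le> score S (out S v) v ?j"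
    using out_score_max[of v "Suc v" "c v" S] c_less[OF assms(2)] by simp
  then have "n * score S (out S v) v (c v) \<le> n * score S (out S v) v ?j"
    by (intro mult_left_mono) auto
  then have "s * ?a (c v) \<le> s * ?a ?j + 4 * (\<eta> * n * s)"
    using score_estimate[OF assms c_less[OF assms(2)]] score_estimate[OF assms out_less[OF k, of S "Suc v" v]]
    by linarith
  also have "\<dots> = s * (?a ?j + 4 * (\<eta> * n))" by (simp add: algebra_simps)
  finally have "?a (c v) \<le> ?a ?j + 4 * (\<eta> * n)"
    using s by (subst (asm) mult_le_cancel_left_pos) auto
  \<comment> \<open>The drift: the current hybrid and the one at the block start differ only on
    \<open>{start v..<v}\<close>.\<close>
  moreover have "affinity lab n (hybrid S c v) v ?j - affinity lab n (hybrid S c v) v (c v)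
      \<ge> ?a ?j - ?a (c v) - 2 * real (v - start v)"
    using start_le[of v] out_stable[of _ "start v" v S]
    by (intro affinity_diff_change) (auto simp: hybrid_def split: if_splits)
  moreover have "real (v - start v) \<le> \<eta> * n" using diff_start_le \<eta> by simp
  ultimately show ?thesis by linarith
qed

text \<open>The changes telescope over the hybrids, from \<open>c\<close> at \<open>v = 0\<close> to
  a colouring that agrees with \<open>out S n\<close> on all vertices at
  \<open>v = n\<close>.\<close>

lemma greedy_loss:
  assumes "lab = edge_label n L"
  shows "colour_agreements n L (out S n)
    \<ge> colour_agreements n L c - 6 * \<eta> * n * n - n * card {v. v < n \<and> \<not> good D S v}"
proof -
  have "colour_agreements n L (hybrid S c v)
      \<ge> colour_agreements n L c - 6 * \<eta> * n * v - n * card {u. u < v \<and> \<not> good D S u}"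
    if "v \<le> n" for v
    using that
  proof (induction v)
    case 0
    have "hybrid S c 0 = c" by (auto simp: hybrid_def)
    then show ?case by simp
  next
    case (Suc v)
    let ?a = "affinity lab n (hybrid S c v) v"
    have upd: "colour_agreements n L (hybrid S c (Suc v))
        = colour_agreements n L (hybrid S c v) + ?a (out S (Suc v) v) - ?a (c v)"
    proof -
      have "hybrid S c v v = c v" by (simp add: hybrid_def)
      moreover have "colour_agreements n L (h(v := j)) = colour_agreements n L h
          + affinity lab n h v j - affinity lab n h v (h v)" for h j
        using Suc.prems by (simp add: assms colour_agreements_upd)
      ultimately show ?thesis unfolding hybrid_Suc by metis
    qed
    show ?case
    proof (cases "good D S v")
      case True
      have "{u. u < Suc v \<and> \<not> good D S u} = {u. u < v \<and> \<not> good D S u}"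
        using True less_Suc_eq by auto
      then show ?thesis
        using upd Suc good_step[OF True] by (simp add: algebra_simps)
    next
      case False
      have "{u. u < Suc v \<and> \<not> good D S u} = insert v {u. u < v \<and> \<not> good D S u}"
        using False less_Suc_eq by auto
      then have "real (card {u. u < Suc v \<and> \<not> good D S u}) = card {u. u < v \<and> \<not> good D S u} + 1"
        by simp
      moreover have "0 \<le> 6 * \<eta> * n" using \<eta> by simp
      ultimately show ?thesis
        using upd Suc affinity_diff_ge[of "hybrid S c v" v "out S (Suc v) v" "c v"]
        by (simp add: algebra_simps)
    qed
  qed
  moreover have "colour_agreements n L (hybrid S c n) = colour_agreements n L (out S n)"
    unfolding colour_agreements_def monochromatic_def hybrid_def
    by (intro sum.cong refl) (auto simp: edges_def subset_eq)
  ultimately show ?thesis by fastforce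
qed

end

section \<open>Numbering of the clusters by sampled representatives\<close>

lemma reps_prefix: "t \<le> m \<Longrightarrow> \<exists>xs. reps S m = reps S t @ xs"
  by (induction m rule: dec_induct) auto

lemma reps_subset: "set (reps S m) \<subseteq> S ` {..<m}"
  by (induction m) (auto simp: less_Suc_eq)

lemma name_le: "name S t \<le> length (reps S t)"
  by (simp add: name_def length_takeWhile_le)

lemma name_eq_length_iff: "name S t = length (reps S t) \<longleftrightarrow> (\<forall>x\<in>set (reps S t). \<not> same (S t) x)"
proof
  assume "name S t = length (reps S t)"
  then have "takeWhile (\<lambda>x. \<not> same (S t) x) (reps S t) = reps S t"
    unfolding name_def by (metis takeWhile_eq_take take_all order_refl)
  then show "\<forall>x\<in>set (reps S t). \<not> same (S t) x" by (metis set_takeWhileD)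
next
  assume "\<forall>x\<in>set (reps S t). \<not> same (S t) x"
  then have "takeWhile (\<lambda>x. \<not> same (S t) x) (reps S t) = reps S t" by (simp add: takeWhile_eq_all_conv)
  then show "name S t = length (reps S t)" unfolding name_def by (rule arg_cong)
qed

text \<open>A point that matches no earlier representative is appended and then represents itself,
  by reflexivity on sampled points. So every name is a valid index into the final list.\<close>

lemma nth_name:
  assumes "\<And>x. x \<in> S ` {..<m} \<Longrightarrow> same x x" "t < m"
  shows "name S t < length (reps S m) \<and> same (S t) (reps S m ! name S t)"
proof -
  obtain xs where xs: "reps S m = reps S (Suc t) @ xs" using reps_prefix[of "Suc t" m S] assms(2) by auto
  have "name S t < length (reps S (Suc t)) \<and> same (S t) (reps S (Suc t) ! name S t)"
  proof (cases "name S t = length (reps S t)")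
    case True
    then show ?thesis using name_eq_length_iff[of S t] assms by simp
  next
    case False
    then have "name S t < length (reps S t)" using name_le[of S t] by simp
    moreover from this have "same (S t) (reps S t ! name S t)"
      unfolding name_def using nth_length_takeWhile by fastforce
    ultimately show ?thesis using name_eq_length_iff[of S t] by auto
  qed
  then show ?thesis by (auto simp: xs nth_append)
qed

lemma reps_separated:
  "j < i \<Longrightarrow> i < length (reps S m) \<Longrightarrow> \<not> same (reps S m ! i) (reps S m ! j)"
proof (induction m)
  case (Suc m)
  then show ?case
    by (cases "i < length (reps S m)") (auto simp: nth_append split: if_splits)
qed simp

end

text \<open>Take the inverse of \<open>f\<close> on its image and send the remaining elements, at
  most \<open>k - r\<close> many, injectively into \<open>{r..<k}\<close>. In this way the clusters
  never met in the sample receive colours that are not names.\<close>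

lemma extend_inj_on:
  fixes r k :: nat
  assumes "finite D" "card D \<le> k" "inj_on f {..<r}" "f ` {..<r} \<subseteq> D"
  obtains \<phi> where "inj_on \<phi> D" "\<phi> ` D \<subseteq> {..<k}" "\<And>i. i < r \<Longrightarrow> \<phi> (f i) = i"
proof -
  have r: "card (f ` {..<r}) = r" using assms(3) by (simp add: card_image)
  have "r \<le> k" using card_mono[OF assms(1,4)] assms(2) r by simp
  have "card (D - f ` {..<r}) \<le> card {r..<k}"
    using assms r by (simp add: card_Diff_subset)
  then obtain g where g: "g ` (D - f ` {..<r}) \<subseteq> {r..<k}" "inj_on g (D - f ` {..<r})"
    using card_le_inj[of "D - f ` {..<r}" "{r..<k}"] assms(1) by auto
  define \<phi> where "\<phi> A = (if A \<in> f ` {..<r} then the_inv_into {..<r} f A else g A)" for A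
  have f: "\<phi> (f i) = i" if "i < r" for i
    using that assms(3) by (auto simp: \<phi>_def the_inv_into_f_f)
  have "inj_on \<phi> D"
  proof (rule inj_onI)
    fix A B assume AB: "A \<in> D" "B \<in> D" "\<phi> A = \<phi> B"
    have *: "\<phi> A < r \<longleftrightarrow> A \<in> f ` {..<r}" if "A \<in> D" for A
      using f g that by (cases "A \<in> f ` {..<r}") (auto simp: \<phi>_def[of A] the_inv_into_f_f[OF assms(3)])
    show "A = B"
    proof (cases "A \<in> f ` {..<r}")
      case True
      then have "\<phi> A < r" using *[OF AB(1)] by blast
      then have "B \<in> f ` {..<r}" using *[OF AB(2)] AB(3) by simp
      with True AB(3) f show ?thesis by auto
    next
      case False
      then have "\<not> \<phi> A < r" using *[OF AB(1)] by blast
      then have "B \<notin> f ` {..<r}" using *[OF AB(2)] AB(3) by simp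
      with False AB g(2) show ?thesis by (auto simp: \<phi>_def dest: inj_onD)
    qed
  qed
  moreover have "\<phi> A < k" if "A \<in> D" for A
    using f g that \<open>r \<le> k\<close> by (cases "A \<in> f ` {..<r}") (auto simp: \<phi>_def[of A] the_inv_into_f_f[OF assms(3)])
  ultimately show ?thesis using f that by blast
qed

context greedy
begin

context
  fixes D :: "nat set set"
  assumes D: "partition_on {..<n} D" and card_D: "card D \<le> k" and same: "same = same_cluster D"
begin

lemma class_map:
  obtains cl where "\<And>u. u < n \<Longrightarrow> cl u \<in> D" "\<And>u v. u < n \<Longrightarrow> v < n \<Longrightarrow> cl u = cl v \<longleftrightarrow> same u v"
proof -
  have "\<forall>u\<in>{..<n}. \<exists>A. A \<in> D \<and> u \<in> A" using D by (auto simp: partition_on_def)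
  then obtain cl where cl: "\<And>u. u < n \<Longrightarrow> cl u \<in> D \<and> u \<in> cl u" by (metis lessThan_iff)
  moreover have "cl u = cl v \<longleftrightarrow> same u v" if "u < n" "v < n" for u v
    using same_cluster_iff[OF D, of "cl u" u v] cl[OF that(1)] cl[OF that(2)] D
    by (auto simp: same partition_on_def disjoint_def)
  ultimately show ?thesis using that by blast
qed

lemma reps_classes:
  assumes "\<And>t. t < m \<Longrightarrow> S t < n" "\<And>u. u < n \<Longrightarrow> cl u \<in> D"
    "\<And>u v. u < n \<Longrightarrow> v < n \<Longrightarrow> cl u = cl v \<longleftrightarrow> same u v"
  shows "inj_on (\<lambda>i. cl (reps S m ! i)) {..<length (reps S m)}"
    "(\<lambda>i. cl (reps S m ! i)) ` {..<length (reps S m)} \<subseteq> D"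
proof -
  have less: "reps S m ! i < n" if "i < length (reps S m)" for i
    using reps_subset[of S m] nth_mem[OF that] assms(1) by auto
  then show "(\<lambda>i. cl (reps S m ! i)) ` {..<length (reps S m)} \<subseteq> D" using assms(2) by auto
  have "cl (reps S m ! i) \<noteq> cl (reps S m ! j)" if "j < i" "i < length (reps S m)" for i j
    using reps_separated[OF that] assms(3)[OF less less] that by auto
  then show "inj_on (\<lambda>i. cl (reps S m ! i)) {..<length (reps S m)}"
    by (intro inj_onI) (metis lessThan_iff linorder_neqE_nat)
qed

text \<open>Distinct representatives lie in distinct clusters. This limits the queries spent on one
  sample point to \<open>k\<close>.\<close>

lemma length_reps_le:
  assumes "\<And>t. t < m \<Longrightarrow> S t < n"
  shows "length (reps S m) \<le> k"
proof -
  obtain cl where cl: "\<And>u. u < n \<Longrightarrow> cl u \<in> D"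
    "\<And>u v. u < n \<Longrightarrow> v < n \<Longrightarrow> cl u = cl v \<longleftrightarrow> same u v"
    using class_map by blast
  have "finite D" using D finite_elements by blast
  then have "card {..<length (reps S m)} \<le> card D"
    using card_inj_on_le reps_classes[where S = S and cl = cl and m = m, OF assms cl] by metis
  then show ?thesis using card_D by simp
qed

text \<open>Names index the clusters met in the sample injectively, and \<open>extend_inj_on\<close>
  colours the rest. The colouring \<open>c\<close> depends on the whole of \<open>S\<close>, which
  is harmless since it serves only to analyse a fixed sample.\<close>

lemma cluster_colouring:
  assumes "\<And>t. t < m \<Longrightarrow> S t < n"
  obtains c where "\<And>u. u < n \<Longrightarrow> c u < k"
    "\<And>u v. u < n \<Longrightarrow> v < n \<Longrightarrow> c u = c v \<longleftrightarrow> same_cluster D u v"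
    "\<And>t. t < m \<Longrightarrow> c (S t) = name S t"
proof -
  obtain cl where cl: "\<And>u. u < n \<Longrightarrow> cl u \<in> D"
    "\<And>u v. u < n \<Longrightarrow> v < n \<Longrightarrow> cl u = cl v \<longleftrightarrow> same u v"
    using class_map by blast
  have fin: "finite D" using D finite_elements by blast
  obtain \<phi> where \<phi>: "inj_on \<phi> D" "\<phi> ` D \<subseteq> {..<k}"
    "\<And>i. i < length (reps S m) \<Longrightarrow> \<phi> (cl (reps S m ! i)) = i"
    using extend_inj_on[OF fin card_D reps_classes[where S = S and cl = cl and m = m, OF assms cl]] by metis
  show ?thesis
  proof (rule that[of "\<lambda>u. \<phi> (cl u)"])
    fix t assume t: "t < m"
    have "same x x" if "x \<in> S ` {..<m}" for x
      using that same_cluster_refl[OF D] assms same by auto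
    from nth_name[of S m t, OF this t]
    have "name S t < length (reps S m)" "same (S t) (reps S m ! name S t)" by auto
    have "reps S m ! name S t \<in> S ` {..<m}"
      using subsetD[OF reps_subset nth_mem[OF \<open>name S t < length (reps S m)\<close>]] .
    then have "reps S m ! name S t < n" using assms by auto
    with \<open>same (S t) (reps S m ! name S t)\<close> have "cl (S t) = cl (reps S m ! name S t)" using cl(2)[OF assms[OF t]] by metis
    then show "\<phi> (cl (S t)) = name S t" using \<phi>(3) \<open>name S t < length (reps S m)\<close> by simp
  next
    fix u assume "u < n"
    then show "\<phi> (cl u) < k" using cl(1) \<phi>(2) by blast
  qed (use cl \<phi> same in \<open>auto simp: inj_on_eq_iff\<close>)
qed

end

end


section \<open>Most vertices are good\<close>

lemma prob_bind_pmf: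
  "measure_pmf.prob (bind_pmf M N) E = measure_pmf.expectation M (\<lambda>x. measure_pmf.prob (N x) E)"
proof -
  have "emeasure (measure_pmf (bind_pmf M N)) E = (\<integral>\<^sup>+ x. emeasure (measure_pmf (N x)) E \<partial>measure_pmf M)"
    by simp
  also have "\<dots> = (\<integral>\<^sup>+ x. ennreal (measure_pmf.prob (N x) E) \<partial>measure_pmf M)"
    by (simp add: measure_pmf.emeasure_eq_measure)
  also have "\<dots> = ennreal (measure_pmf.expectation M (\<lambda>x. measure_pmf.prob (N x) E))"
    by (intro nn_integral_eq_integral measure_pmf.integrable_const_bound[where B = 1]) auto
  finally show ?thesis
    by (simp add: measure_pmf.emeasure_eq_measure integral_nonneg_AE)
qed

lemma prob_bind_pmf_le:
  assumes "\<And>x. x \<in> set_pmf M \<Longrightarrow> measure_pmf.prob (N x) E \<le> b"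
  shows "measure_pmf.prob (bind_pmf M N) E \<le> b"
  unfolding prob_bind_pmf
  by (intro measure_pmf.integral_le_const measure_pmf.integrable_const_bound[where B = 1] AE_pmfI)
    (use assms in auto)

lemma prob_bind_pmf_ge:
  assumes "\<And>x. x \<in> set_pmf M \<Longrightarrow> b \<le> measure_pmf.prob (N x) E"
  shows "b \<le> measure_pmf.prob (bind_pmf M N) E"
  unfolding prob_bind_pmf
  by (intro measure_pmf.integral_ge_const measure_pmf.integrable_const_bound[where B = 1] AE_pmfI)
    (use assms in auto)

abbreviation uniform_sample :: "nat \<Rightarrow> nat set \<Rightarrow> (nat \<Rightarrow> nat) pmf" where
  "uniform_sample n I \<equiv> Pi_pmf I 0 (\<lambda>_. pmf_of_set {..<n})"

text \<open>The summands lie in an interval of length 2, so Hoeffding's exponent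
  \<open>2 * card I * \<eta>\<^sup>2 / 2\<^sup>2\<close> becomes
  \<open>card I * \<eta>\<^sup>2 / 2\<close>.\<close>

lemma uniform_sample_Hoeffding:
  fixes f :: "nat \<Rightarrow> real" and \<eta> :: real
  assumes "finite I" "I \<noteq> {}" "n \<ge> 1" "\<eta> > 0" and f: "\<And>u. \<bar>f u\<bar> \<le> 1"
  shows "measure_pmf.prob (uniform_sample n I)
      {S. \<not> \<bar>n * (\<Sum>t\<in>I. f (S t)) - card I * (\<Sum>u<n. f u)\<bar> < \<eta> * n * card I}
    \<le> 2 * exp (- (card I * \<eta>\<^sup>2 / 2))"
proof -
  obtain i0 where i0: "i0 \<in> I" using assms(2) by blast
  let ?M = "uniform_sample n I"
  have component: "map_pmf (\<lambda>S. S i) ?M = pmf_of_set {..<n}" if "i \<in> I" for i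
    using that assms(1) by (simp add: Pi_pmf_component)
  have distr: "distr (measure_pmf ?M) borel (\<lambda>S. f (S i))
      = distr (measure_pmf (pmf_of_set {..<n})) borel f" if "i \<in> I" for i
  proof -
    have "distr (measure_pmf (map_pmf (\<lambda>S. S i) ?M)) borel f = distr (measure_pmf ?M) borel (\<lambda>S. f (S i))"
      unfolding map_pmf_rep_eq by (subst distr_distr) (auto simp: o_def)
    then show ?thesis by (simp only: component[OF that])
  qed
  interpret Hoeffding_ineq_iid "measure_pmf ?M" I "\<lambda>i S. f (S i)" "\<lambda>S. f (S i0)" "- 1" 1
    "measure_pmf.expectation ?M (\<lambda>S. f (S i0))"
  proof unfold_locales
    show "prob_space.indep_vars (measure_pmf ?M) (\<lambda>_. borel) (\<lambda>i S. f (S i)) I"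
      by (intro prob_space.indep_vars_compose2[OF _ indep_vars_Pi_pmf])
        (auto simp: measure_pmf.prob_space_axioms assms(1))
    show "AE S in measure_pmf ?M. f (S i0) \<in> {- 1..1}"
      using f by (auto simp: abs_le_iff minus_le_iff)
  qed (use assms(1) distr i0 in auto)
  have "measure_pmf.expectation ?M (\<lambda>S. f (S i0)) = measure_pmf.expectation (map_pmf (\<lambda>S. S i0) ?M) f"
    by simp
  also have "\<dots> = measure_pmf.expectation (pmf_of_set {..<n}) f"
    by (simp only: component[OF i0])
  also have "\<dots> = (\<Sum>u<n. f u) / n"
    using assms(3) by (subst integral_pmf_of_set) (auto simp: lessThan_empty_iff)
  finally have mean: "measure_pmf.expectation ?M (\<lambda>S. f (S i0)) = (\<Sum>u<n. f u) / n" .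
  have pos: "card I > 0" using assms(1,2) by (simp add: card_gt_0_iff)
  have "{S. \<not> \<bar>n * (\<Sum>t\<in>I. f (S t)) - card I * (\<Sum>u<n. f u)\<bar> < \<eta> * n * card I}
      = {S. \<eta> \<le> \<bar>(\<Sum>t\<in>I. f (S t)) / card I - (\<Sum>u<n. f u) / n\<bar>}"
  proof (intro Collect_cong)
    fix S
    have "n * (\<Sum>t\<in>I. f (S t)) - card I * (\<Sum>u<n. f u)
        = ((\<Sum>t\<in>I. f (S t)) / card I - (\<Sum>u<n. f u) / n) * (n * card I)"
      using pos assms(3) by (simp add: field_simps)
    then have "\<bar>n * (\<Sum>t\<in>I. f (S t)) - card I * (\<Sum>u<n. f u)\<bar>
        = \<bar>(\<Sum>t\<in>I. f (S t)) / card I - (\<Sum>u<n. f u) / n\<bar> * (n * card I)"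
      by (simp add: abs_mult)
    then show "\<not> \<bar>n * (\<Sum>t\<in>I. f (S t)) - card I * (\<Sum>u<n. f u)\<bar> < \<eta> * n * card I
        \<longleftrightarrow> \<eta> \<le> \<bar>(\<Sum>t\<in>I. f (S t)) / card I - (\<Sum>u<n. f u) / n\<bar>"
      using pos assms(3) by (simp add: mult.assoc not_less)
  qed
  then show ?thesis
    using Hoeffding_ineq_abs_ge'[of \<eta>] assms(2,4) mean by simp
qed

context greedy
begin

text \<open>Conditionally on the other sample points, the sample of a block is still uniform.\<close>

lemma prob_not_accurate:
  assumes "n \<ge> 1" "s \<ge> 1" "\<eta> > 0" "off v + s \<le> m"
    and X: "\<And>S S'. (\<And>t. t < off v \<Longrightarrow> S t = S' t) \<Longrightarrow> X S = X S'"
  shows "measure_pmf.prob (uniform_sample n {..<m}) {S. \<not> accurate S v (X S)} \<le> 2 * exp (- (s * \<eta>\<^sup>2 / 2))"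
proof -
  let ?I = "{off v..<off v + s}" and ?J = "{..<m} - {off v..<off v + s}"
  let ?merge = "\<lambda>f g t. if t \<in> ?J then f t else g t"
  let ?E = "{S. \<not> accurate S v (X S)}"
  have J: "?J \<union> ?I = {..<m}" using assms(4) by auto
  have "uniform_sample n (?J \<union> ?I)
      = map_pmf (\<lambda>(f, g). ?merge f g) (pair_pmf (uniform_sample n ?J) (uniform_sample n ?I))"
    by (rule Pi_pmf_union) auto
  also have "\<dots> = bind_pmf (uniform_sample n ?J) (\<lambda>f. map_pmf (?merge f) (uniform_sample n ?I))"
    by (simp add: pair_pmf_def map_bind_pmf map_pmf_def bind_assoc_pmf bind_return_pmf)
  finally have eq: "uniform_sample n {..<m}
      = bind_pmf (uniform_sample n ?J) (\<lambda>f. map_pmf (?merge f) (uniform_sample n ?I))"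
    unfolding J .
  show ?thesis
    unfolding eq
  proof (rule prob_bind_pmf_le)
    fix f
    let ?h = "\<lambda>u. if u \<in> X f then sign_label lab v u else 0"
    \<comment> \<open>\<open>X\<close> looks only at indices below \<open>off v\<close>, whose
      values all come from \<open>f\<close>; the tested set stays constant while \<open>g\<close>
      varies.\<close>
    have "X (?merge f g) = X f" for g
      by (rule X) (use assms(4) in auto)
    moreover have "(\<Sum>t\<in>?I. ?h (?merge f g t)) = (\<Sum>t\<in>?I. ?h (g t))" for g
      by (intro sum.cong) auto
    ultimately have "?merge f -` ?E
        = {g. \<not> \<bar>n * (\<Sum>t\<in>?I. ?h (g t)) - card ?I * (\<Sum>u<n. ?h u)\<bar> < \<eta> * n * card ?I}"
      by (simp only: accurate_def vimage_def mem_Collect_eq card_atLeastLessThan add_diff_cancel_left')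
    then show "measure_pmf.prob (map_pmf (?merge f) (uniform_sample n ?I)) ?E \<le> 2 * exp (- (s * \<eta>\<^sup>2 / 2))"
      using uniform_sample_Hoeffding[where I = ?I and n = n and \<eta> = \<eta> and f = ?h] assms(1-3) abs_sign_label_le
      by (simp add: measure_map_pmf)
  qed
qed

text \<open>Union bound over the \<open>k\<close> coloured parts and the at most \<open>k\<close>
  parts of clusters, each failing with probability at most \<open>?b\<close>.\<close>

lemma prob_not_good:
  assumes "n \<ge> 1" "s \<ge> 1" "\<eta> > 0" "off v + s \<le> m" "finite D" "card D \<le> k"
  shows "measure_pmf.prob (uniform_sample n {..<m}) {S. \<not> good D S v} \<le> 4 * k * exp (- (s * \<eta>\<^sup>2 / 2))"
proof -
  let ?M = "measure_pmf (uniform_sample n {..<m})" and ?b = "2 * exp (- (s * \<eta>\<^sup>2 / 2))"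
  let ?X = "\<lambda>j S. {u \<in> {..<start v}. out S (start v) u = j}" and ?Y = "\<lambda>A. {u \<in> A. start v \<le> u}"
  let ?E = "\<lambda>j. {S. \<not> accurate S v (?X j S)}" and ?F = "\<lambda>A. {S. \<not> accurate S v (?Y A)}"
  have "{S. \<not> good D S v} = (\<Union>j<k. ?E j) \<union> (\<Union>A\<in>D. ?F A)"
    by (auto simp: good_def test_sets_def)
  then have "measure ?M {S. \<not> good D S v} \<le> measure ?M (\<Union>j<k. ?E j) + measure ?M (\<Union>A\<in>D. ?F A)"
    by (simp add: measure_Un_le)
  also have "measure ?M (\<Union>j<k. ?E j) \<le> (\<Sum>j<k. measure ?M (?E j))"
    by (intro measure_UNION_le) auto
  also have "\<dots> \<le> (\<Sum>j<k. ?b)"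
  proof (intro sum_mono prob_not_accurate assms)
    fix j and S S' :: "nat \<Rightarrow> nat" assume "\<And>t. t < off v \<Longrightarrow> S t = S' t"
    then have "out S (start v) = out S' (start v)" by (rule out_start_cong)
    then show "?X j S = ?X j S'" by (simp only:)
  qed
  also have "measure ?M (\<Union>A\<in>D. ?F A) \<le> (\<Sum>A\<in>D. measure ?M (?F A))"
    using assms(5) by (intro measure_UNION_le) auto
  also have "\<dots> \<le> (\<Sum>A\<in>D. ?b)"
    by (intro sum_mono prob_not_accurate assms) auto
  also have "(\<Sum>j<k. ?b) + (\<Sum>A\<in>D. ?b) \<le> (\<Sum>j<k. ?b) + k * ?b"
    using assms(6) by simp
  finally show ?thesis by simp
qed

text \<open>Only the expected number of bad vertices enters, so the strong dependence between
  vertices that share a sample does no harm.\<close>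

lemma prob_many_not_good:
  assumes "n \<ge> 1" "s \<ge> 1" "\<eta> > 0" "(1 / \<eta> + 1) * s \<le> m" "finite D" "card D \<le> k"
  shows "measure_pmf.prob (uniform_sample n {..<m}) {S. \<eta> * n \<le> card {v. v < n \<and> \<not> good D S v}}
    \<le> 4 * k * exp (- (s * \<eta>\<^sup>2 / 2)) / \<eta>"
proof -
  let ?M = "measure_pmf (uniform_sample n {..<m})" and ?b = "4 * k * exp (- (s * \<eta>\<^sup>2 / 2))"
  let ?f = "\<lambda>S. real (card {v. v < n \<and> \<not> good D S v})"
  have f: "?f S = (\<Sum>v<n. indicator {S. \<not> good D S v} S)" for S
    by (simp add: indicator_def sum.If_cases Int_def)
  have "integral\<^sup>L ?M ?f = (\<Sum>v<n. measure ?M {S. \<not> good D S v})"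
    unfolding f by (subst Bochner_Integration.integral_sum)
      (auto intro!: measure_pmf.integrable_const_bound[where B = 1])
  also have "\<dots> \<le> (\<Sum>v<n. ?b)"
  proof (intro sum_mono prob_not_good assms)
    fix v assume "v \<in> {..<n}"
    then have "real (off v + s) \<le> real m"
      using off_bound[of v] assms(3,4) by fastforce
    then show "off v + s \<le> m" by linarith
  qed
  finally have E: "integral\<^sup>L ?M ?f \<le> n * ?b" by simp
  have "integrable ?M ?f"
    unfolding f by (intro Bochner_Integration.integrable_sum measure_pmf.integrable_const_bound[where B = 1]) auto
  then have "measure ?M {S \<in> space ?M. \<eta> * n \<le> ?f S} \<le> integral\<^sup>L ?M ?f / (\<eta> * n)"
    using assms(1,3) by (intro integral_Markov_inequality_measure[where A = UNIV]) auto
  also have "\<dots> \<le> n * ?b / (\<eta> * n)"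
    using E assms(1,3) by (intro divide_right_mono) auto
  finally show ?thesis using assms(1) by simp
qed

end


section \<open>The program\<close>

text \<open>With \<open>\<eta> = \<epsilon> / 16\<close>, the factor 64 = 4 * 16 comes from the
  bound \<open>4 * k * exp (...) / \<eta>\<close> in \<open>prob_many_not_good\<close>, and 512 = 2
  * 16^2 cancels the factor in the exponent \<open>s * \<eta>\<^sup>2 / 2\<close>. The counter
  \<open>s\<close> starts from its initial value 0.\<close>

definition set_sizes :: com where
  "set_sizes =
     (RAssign ''x'' (RDiv (RMul (OfNat (Num 64)) (OfNat (Var ''k''))) (RMul (RVar ''eps'') (RVar ''delta''))) ;;
      Assign ''l'' (Num 1)) ;;
     While (RLess (OfNat (Num 1)) (RVar ''x''))
       (RAssign ''x'' (RDiv (RVar ''x'') (OfNat (Num 2))) ;; Assign ''l'' (Add (Var ''l'') (Num 1))) ;;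
     While (RLess (OfNat (Var ''s'')) (RDiv (RMul (OfNat (Num 512)) (OfNat (Var ''l''))) (RMul (RVar ''eps'') (RVar ''eps''))))
       (Assign ''s'' (Add (Var ''s'') (Num 1)))"

definition draw_samples :: com where
  "draw_samples =
     While (RLess (OfNat (Var ''m'')) (RMul (RAdd (RDiv (OfNat (Num 16)) (RVar ''eps'')) (OfNat (Num 1))) (OfNat (Var ''s''))))
       (Rand ''u'' (Var ''n'') ;;
        (Store ''S'' (Var ''m'') (Var ''u'') ;; Assign ''m'' (Add (Var ''m'') (Num 1))))"

text \<open>Truncated arithmetic replaces a branch: after a hit \<open>q\<close> is 1 and
  \<open>j\<close> stays, after a miss \<open>j\<close> advances. The loop stops at the first match
  or at \<open>j = r\<close>.\<close>

definition find_rep :: com where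
  "find_rep =
     While (Conj (Less (Var ''j'') (Var ''r'')) (Less (Var ''q'') (Num 1)))
       (SameCluster ''q'' (Elem ''S'' (Var ''t'')) (Elem ''rep'' (Var ''j'')) ;;
        Assign ''j'' (Sub (Add (Var ''j'') (Num 1)) (Var ''q'')))"

definition name_samples :: com where
  "name_samples =
     While (Less (Var ''t'') (Var ''m''))
       ((Assign ''j'' (Num 0) ;; Assign ''q'' (Num 0)) ;;
        find_rep ;;
        (Cond (Less (Var ''j'') (Var ''r'')) Skip
           (Store ''rep'' (Var ''r'') (Elem ''S'' (Var ''t'')) ;; Assign ''r'' (Add (Var ''r'') (Num 1))) ;;
         Store ''name'' (Var ''t'') (Var ''j'') ;;
         Assign ''t'' (Add (Var ''t'') (Num 1))))"

definition nat_eq :: "nexp \<Rightarrow> nexp \<Rightarrow> bexp" where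
  "nat_eq a b = Conj (Neg (Less a b)) (Neg (Less b a))"

text \<open>The sign of a label is computed as \<open>y + y - 1\<close> in the reals, since
  subtraction of naturals would truncate it at 0.\<close>

definition compute_score :: com where
  "compute_score =
     While (Less (Var ''t'') (Add (Var ''off'') (Var ''s'')))
       (Assign ''u'' (Elem ''S'' (Var ''t'')) ;;
        Cond (Less (Var ''u'') (Var ''b''))
          (Assign ''c'' (Elem ''out'' (Var ''u''))) (Assign ''c'' (Elem ''name'' (Var ''t''))) ;;
        Cond (Conj (nat_eq (Var ''c'') (Var ''j'')) (Neg (nat_eq (Var ''u'') (Var ''v''))))
          (Label ''y'' (Var ''v'') (Var ''u'') ;;
           RAssign ''sc'' (RAdd (RVar ''sc'') (RSub (OfNat (Add (Var ''y'') (Var ''y''))) (OfNat (Num 1)))))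
          Skip ;;
        Assign ''t'' (Add (Var ''t'') (Num 1)))"

text \<open>The test says \<open>j = 0\<close> or \<open>bs < sc\<close>, written without a
  disjunction. It mirrors the definition of \<open>best\<close>: when the first colour is tried, no
  best score has been stored yet.\<close>

definition choose_colour :: com where
  "choose_colour =
     While (Less (Var ''j'') (Var ''k''))
       ((RAssign ''sc'' (OfNat (Num 0)) ;; Assign ''t'' (Var ''off'')) ;;
        compute_score ;;
        (Cond (Neg (Conj (Less (Num 0) (Var ''j'')) (Neg (RLess (RVar ''bs'') (RVar ''sc'')))))
           (Assign ''best'' (Var ''j'') ;; RAssign ''bs'' (RVar ''sc'')) Skip ;;
         Assign ''j'' (Add (Var ''j'') (Num 1))))"

definition colour_vertices :: com where
  "colour_vertices =
     While (Less (Var ''v'') (Var ''n''))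
       ((Cond (RLess (RMul (RDiv (RVar ''eps'') (OfNat (Num 16))) (OfNat (Var ''n''))) (OfNat (Sub (Var ''v'') (Var ''b''))))
           (Assign ''b'' (Var ''v'') ;; Assign ''off'' (Add (Var ''off'') (Var ''s''))) Skip ;;
         Assign ''j'' (Num 0)) ;;
        choose_colour ;;
        (Store ''out'' (Var ''v'') (Var ''best'') ;; Assign ''v'' (Add (Var ''v'') (Num 1))))"

definition query_max_ag :: com where
  "query_max_ag = set_sizes ;; draw_samples ;; name_samples ;; colour_vertices"

lemma bval_nat_eq [simp]: "bval (nat_eq a b) s \<longleftrightarrow> nval a s = nval b s"
  by (auto simp: nat_eq_def)

lemma store_sel [simp]:
  "nvar (set_nvar x i s) = (nvar s)(x := i)" "arr (set_nvar x i s) = arr s"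
  "rvar (set_nvar x i s) = rvar s" "queries (set_nvar x i s) = queries s"
  "nvar (set_arr A i j s) = nvar s" "arr (set_arr A i j s) = (arr s)(A := (arr s A)(i := j))"
  "rvar (set_arr A i j s) = rvar s" "queries (set_arr A i j s) = queries s"
  "nvar (set_rvar x r s) = nvar s" "arr (set_rvar x r s) = arr s"
  "rvar (set_rvar x r s) = (rvar s)(x := r)" "queries (set_rvar x r s) = queries s"
  by (simp_all add: set_nvar_def set_arr_def set_rvar_def)

lemma less_nat_ceiling_iff: "real i < x \<longleftrightarrow> i < nat \<lceil>x\<rceil>"
  by linarith


section \<open>Verification of the program\<close>

text \<open>Without rounding and logarithms, the program finds this number by halving \<^term>\<open>x\<close>.\<close>

definition log_size :: "real \<Rightarrow> nat" where
  "log_size x = 1 + nat \<lceil>log 2 x\<rceil>"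

lemma halving_iff:
  assumes "x > 0"
  shows "1 < x / 2 ^ i \<longleftrightarrow> i < nat \<lceil>log 2 x\<rceil>"
proof -
  have "1 < x / 2 ^ i \<longleftrightarrow> 2 powr i < x" by (simp add: powr_realpow field_simps)
  also have "\<dots> \<longleftrightarrow> real i < log 2 x" using assms by (simp add: less_log_iff)
  finally show ?thesis by (simp only: less_nat_ceiling_iff)
qed

definition sample_size :: "real \<Rightarrow> nat \<Rightarrow> nat" where
  "sample_size \<epsilon> l = nat \<lceil>512 * real l / (\<epsilon> * \<epsilon>)\<rceil>"

definition sample_number :: "real \<Rightarrow> nat \<Rightarrow> nat" where
  "sample_number \<epsilon> s = nat \<lceil>(16 / \<epsilon> + 1) * s\<rceil>"

context oracles
begin

lemma runs_set_sizes:
  assumes "\<epsilon> > 0" "\<delta> > 0" "k \<ge> 1"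
  defines "l \<equiv> log_size (64 * real k / (\<epsilon> * \<delta>))"
  shows "runs set_sizes (init_store \<epsilon> \<delta> k n) (5 * l + 3 * sample_size \<epsilon> l + 7)
    (\<lambda>st. (\<forall>x. x \<noteq> ''l'' \<and> x \<noteq> ''s'' \<longrightarrow> nvar st x = nvar (init_store \<epsilon> \<delta> k n) x)
       \<and> nvar st ''s'' = sample_size \<epsilon> l \<and> arr st = (\<lambda>_ _. 0) \<and> rvar st ''eps'' = \<epsilon> \<and> queries st = 0)"
    (is "runs _ ?init _ ?Q")
proof -
  define X where "X = 64 * real k / (\<epsilon> * \<delta>)"
  define N where "N = nat \<lceil>log 2 X\<rceil>"
  define R where "R = 512 * real l / (\<epsilon> * \<epsilon>)"
  have l: "l = Suc N" by (simp add: l_def log_size_def N_def X_def)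
  have halving: "1 < X / 2 ^ i \<longleftrightarrow> i < N" for i
    unfolding N_def by (rule halving_iff) (use assms in \<open>simp add: X_def\<close>)
  have size: "real i < R \<longleftrightarrow> i < sample_size \<epsilon> l" for i
    unfolding R_def sample_size_def by (rule less_nat_ceiling_iff)
  define frame where "frame st \<longleftrightarrow> (\<forall>x. x \<noteq> ''l'' \<and> x \<noteq> ''s'' \<longrightarrow> nvar st x = nvar ?init x)
    \<and> arr st = (\<lambda>_ _. 0) \<and> rvar st ''eps'' = \<epsilon> \<and> queries st = 0" for st :: store
  define I where "I i st \<longleftrightarrow> frame st \<and> nvar st ''l'' = Suc i \<and> nvar st ''s'' = 0 \<and> rvar st ''x'' = X / 2 ^ i"
    for i and st :: store
  define J where "J i st \<longleftrightarrow> frame st \<and> nvar st ''l'' = l \<and> nvar st ''s'' = i" for i and st :: store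
  let ?start = "RAssign ''x'' (RDiv (RMul (OfNat (Num 64)) (OfNat (Var ''k''))) (RMul (RVar ''eps'') (RVar ''delta''))) ;;
      Assign ''l'' (Num 1)"
  let ?b1 = "RLess (OfNat (Num 1)) (RVar ''x'')"
  let ?c1 = "RAssign ''x'' (RDiv (RVar ''x'') (OfNat (Num 2))) ;; Assign ''l'' (Add (Var ''l'') (Num 1))"
  let ?b2 = "RLess (OfNat (Var ''s'')) (RDiv (RMul (OfNat (Num 512)) (OfNat (Var ''l''))) (RMul (RVar ''eps'') (RVar ''eps'')))"
  let ?c2 = "Assign ''s'' (Add (Var ''s'') (Num 1))"
  have start: "runs ?start ?init 3 (I 0)"
    by (rule runs_straight) (simp_all add: I_def frame_def init_store_def X_def)
  have halve: "runs (While ?b1 ?c1) st (N * 5 + 1) (I N)" if "I 0 st" for st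
  proof (rule runs_for[where tc = 3 and I = I, OF that])
    fix i st assume "i < N" "I i st"
    moreover from this(2) have "runs ?c1 st 3 (I (Suc i))"
      by (intro runs_straight) (simp_all add: I_def frame_def)
    ultimately show "bval ?b1 st \<and> runs ?c1 st 3 (I (Suc i))" using halving[of i] by (simp add: I_def)
  next
    fix st assume "I N st"
    then show "\<not> bval ?b1 st" using halving[of N] by (simp add: I_def)
  qed simp
  have size_loop: "runs (While ?b2 ?c2) st (sample_size \<epsilon> l * 3 + 1) (J (sample_size \<epsilon> l))" if "J 0 st" for st
  proof (rule runs_for[where tc = 1 and I = J, OF that])
    fix i st assume "i < sample_size \<epsilon> l" "J i st"
    moreover from this(2) have "runs ?c2 st 1 (J (Suc i))"
      by (intro runs_straight) (simp_all add: J_def frame_def)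
    ultimately show "bval ?b2 st \<and> runs ?c2 st 1 (J (Suc i))"
      using size[of i] by (simp add: J_def frame_def R_def)
  next
    fix st assume "J (sample_size \<epsilon> l) st"
    then show "\<not> bval ?b2 st" using size[of "sample_size \<epsilon> l"] by (simp add: J_def frame_def R_def)
  qed simp
  have "runs set_sizes ?init (3 + 1 + ((N * 5 + 1) + 1 + (sample_size \<epsilon> l * 3 + 1))) (J (sample_size \<epsilon> l))"
    unfolding set_sizes_def
  proof (rule runs_Seq[OF start _ order_refl], rule runs_Seq[OF halve _ order_refl])
    fix st assume "I N st"
    then have "J 0 st" by (simp add: I_def J_def l)
    then show "runs (While ?b2 ?c2) st (sample_size \<epsilon> l * 3 + 1) (J (sample_size \<epsilon> l))" by (rule size_loop)
  qed
  then show ?thesis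
    by (rule runs_weaken) (simp_all add: l J_def frame_def)
qed

text \<open>The law of the store matters here, so the loop is treated through
  \<open>halts_with\<close>. The claim allows an array of which \<open>i\<close> cells are already
  filled, and the induction goes downwards from \<open>N\<close>.\<close>

lemma halts_with_draw_samples:
  fixes f :: "nat \<Rightarrow> nat"
  assumes "n \<ge> 1" "\<And>i. real i < R \<longleftrightarrow> i < N"
    and "i \<le> N" "nvar st ''m'' = i" "nvar st ''n'' = n" "arr st ''S'' = f"
    and "(16 / rvar st ''eps'' + 1) * nvar st ''s'' = R"
  shows "\<exists>M. halts_with draw_samples st ((N - i) * 7 + 1) M \<and>
    map_pmf (\<lambda>st'. arr st' ''S'') M
      = map_pmf (\<lambda>g t. if t \<in> {i..<N} then g t else f t) (uniform_sample n {i..<N}) \<and>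
    (\<forall>st'\<in>set_pmf M. (\<forall>x. x \<noteq> ''m'' \<and> x \<noteq> ''u'' \<longrightarrow> nvar st' x = nvar st x) \<and> nvar st' ''m'' = N \<and>
       (\<forall>A. A \<noteq> ''S'' \<longrightarrow> arr st' A = arr st A) \<and> rvar st' = rvar st \<and> queries st' = queries st)"
    (is "\<exists>M. ?P i st f M")
  using assms(3-)
proof (induction i arbitrary: st f rule: inc_induct)
  case base
  have "halts_with draw_samples st (Suc 0) (return_pmf st)"
    unfolding draw_samples_def by (rule halts_with_While_end) (use base assms(2)[of N] in simp)
  then show ?case using base by (intro exI[of _ "return_pmf st"]) auto
next
  case (step i)
  let ?body = "Store ''S'' (Var ''m'') (Var ''u'') ;; Assign ''m'' (Add (Var ''m'') (Num 1))"
  define next_st where "next_st u = exec ?body (set_nvar ''u'' u st)" for u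
  have "\<exists>M. ?P (Suc i) (next_st u) (f(i := u)) M" for u
    by (rule step.IH) (use step.prems in \<open>auto simp: next_st_def\<close>)
  then have "\<exists>M. \<forall>u. ?P (Suc i) (next_st u) (f(i := u)) (M u)" by (intro choice allI)
  then obtain M where M: "\<forall>u. ?P (Suc i) (next_st u) (f(i := u)) (M u)" ..
  note halts = M[rule_format, THEN conjunct1]
    and distr = M[rule_format, THEN conjunct2, THEN conjunct1]
    and frame = M[rule_format, THEN conjunct2, THEN conjunct2, rule_format]
  let ?U = "pmf_of_set {..<n}"
  have "steps lab same 0 = return_pmf" by (simp add: fun_eq_iff)
  then have "halts_with (Rand ''u'' (Var ''n'')) st 1 (map_pmf (\<lambda>u. set_nvar ''u'' u st) ?U)"
    using step.prems assms(1) by (simp add: halts_with_def pmf.map_comp o_def bind_return_pmf' max_def)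
  moreover have "halts_with ?body st' 3 (return_pmf (exec ?body st'))" for st'
    using halts_with_straight[of ?body st'] by (simp add: numeral_3_eq_3)
  ultimately have "halts_with (Rand ''u'' (Var ''n'') ;; ?body) st 5 (map_pmf next_st ?U)"
    using halts_with_Seq[of "Rand ''u'' (Var ''n'')" st 1 "map_pmf (\<lambda>u. set_nvar ''u'' u st) ?U" ?body 3 "\<lambda>st'. return_pmf (exec ?body st')"]
    by (simp add: bind_map_pmf next_st_def map_pmf_def bind_assoc_pmf bind_return_pmf)
  \<comment> \<open>The continuation must be a function of the store, so the drawn value is read
    back from cell \<open>i\<close> of the array.\<close>
  then have "halts_with ((Rand ''u'' (Var ''n'') ;; ?body) ;; draw_samples) st (5 + 1 + ((N - Suc i) * 7 + 1))
      (bind_pmf (map_pmf next_st ?U) (\<lambda>st'. M (arr st' ''S'' i)))"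
  proof (rule halts_with_Seq)
    fix st' assume "st' \<in> set_pmf (map_pmf next_st ?U)"
    then obtain u where u: "st' = next_st u" by auto
    then have "arr st' ''S'' i = u" using step.prems by (simp add: next_st_def)
    then show "halts_with draw_samples st' ((N - Suc i) * 7 + 1) (M (arr st' ''S'' i))"
      using halts[of u] u by simp
  qed
  moreover have "bind_pmf (map_pmf next_st ?U) (\<lambda>st'. M (arr st' ''S'' i)) = bind_pmf ?U M"
    using step.prems by (simp add: bind_map_pmf next_st_def)
  ultimately have halt: "halts_with draw_samples st (Suc (5 + 1 + ((N - Suc i) * 7 + 1))) (bind_pmf ?U M)"
    unfolding draw_samples_def using step.prems step.hyps assms(2)[of i] by (intro halts_with_While) simp_all
  have time: "Suc (5 + 1 + ((N - Suc i) * 7 + 1)) = (N - i) * 7 + 1"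
    unfolding Suc_diff_Suc[OF step.hyps(2), symmetric] by simp
  have dist: "map_pmf (\<lambda>st'. arr st' ''S'') (bind_pmf ?U M)
      = map_pmf (\<lambda>g t. if t \<in> {i..<N} then g t else f t) (uniform_sample n {i..<N})"
  proof -
    have "map_pmf (\<lambda>st'. arr st' ''S'') (bind_pmf ?U M) = bind_pmf ?U (\<lambda>u.
        map_pmf (\<lambda>g t. if t \<in> {Suc i..<N} then g t else (f(i := u)) t) (uniform_sample n {Suc i..<N}))"
      unfolding map_bind_pmf distr ..
    also have "\<dots> = bind_pmf ?U (\<lambda>u.
        map_pmf (\<lambda>g t. if t \<in> {i..<N} then (g(i := u)) t else f t) (uniform_sample n {Suc i..<N}))"
      using step.hyps by (intro bind_pmf_cong refl map_pmf_cong) auto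
    also have "\<dots> = map_pmf (\<lambda>g t. if t \<in> {i..<N} then g t else f t) (uniform_sample n (insert i {Suc i..<N}))"
      by (subst Pi_pmf_insert') (auto simp: map_bind_pmf map_pmf_def bind_assoc_pmf bind_return_pmf)
    also have "insert i {Suc i..<N} = {i..<N}" using step.hyps by auto
    finally show ?thesis .
  qed
  have fr: "(\<forall>x. x \<noteq> ''m'' \<and> x \<noteq> ''u'' \<longrightarrow> nvar st' x = nvar st x) \<and> nvar st' ''m'' = N \<and>
       (\<forall>A. A \<noteq> ''S'' \<longrightarrow> arr st' A = arr st A) \<and> rvar st' = rvar st \<and> queries st' = queries st"
    if st': "st' \<in> set_pmf (bind_pmf ?U M)" for st'
  proof -
    obtain u where "st' \<in> set_pmf (M u)" using st' unfolding set_bind_pmf by blast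
    from frame[OF this] show ?thesis by (simp add: next_st_def)
  qed
  show ?case by (rule exI, rule conjI[OF halt[unfolded time] conjI[OF dist ballI[OF fr]]])
qed

end

context greedy
begin

section \<open>Timed correctness of the deterministic phases\<close>

lemma runs_find_rep:
  assumes "nvar st ''j'' = 0" "nvar st ''q'' = 0" "nvar st ''t'' = t" "nvar st ''r'' = length (reps S t)"
    and "\<And>i. i < length (reps S t) \<Longrightarrow> arr st ''rep'' i = reps S t ! i" "arr st ''S'' = S"
  shows "runs find_rep st (5 * length (reps S t) + 6)
    (\<lambda>st'. (\<forall>x. x \<noteq> ''j'' \<and> x \<noteq> ''q'' \<longrightarrow> nvar st' x = nvar st x) \<and> arr st' = arr st \<and> rvar st' = rvar st
       \<and> nvar st' ''j'' = name S t \<and> queries st' \<le> queries st + length (reps S t))"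
proof -
  let ?R = "reps S t"
  \<comment> \<open>An iteration makes one query and raises \<open>j + q\<close> by one, whether it
    hits or misses; this is how the queries are counted.\<close>
  define I where "I st' \<longleftrightarrow>
    (\<forall>x. x \<noteq> ''j'' \<and> x \<noteq> ''q'' \<longrightarrow> nvar st' x = nvar st x) \<and> arr st' = arr st \<and> rvar st' = rvar st
    \<and> nvar st' ''j'' \<le> length ?R \<and> nvar st' ''q'' \<le> 1 \<and> (\<forall>i<nvar st' ''j''. \<not> same (S t) (?R ! i))
    \<and> (nvar st' ''q'' = 1 \<longrightarrow> nvar st' ''j'' < length ?R \<and> same (S t) (?R ! nvar st' ''j''))
    \<and> queries st' \<le> queries st + nvar st' ''j'' + nvar st' ''q''" for st' :: store
  have "runs find_rep st (5 * length ?R + 6)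
      (\<lambda>st'. I st' \<and> \<not> bval (Conj (Less (Var ''j'') (Var ''r'')) (Less (Var ''q'') (Num 1))) st')"
    unfolding find_rep_def
  \<comment> \<open>On a hit \<open>j\<close> does not move, so the variant must also register the
    change of \<open>q\<close> from 0 to 1.\<close>
  proof (rule runs_While[where f = "\<lambda>st'. (length ?R - nvar st' ''j'') + (1 - nvar st' ''q'')" and tc = 3])
    show "I st" using assms by (simp add: I_def)
  next
    fix st' assume "I st'" "bval (Conj (Less (Var ''j'') (Var ''r'')) (Less (Var ''q'') (Num 1))) st'"
    then show "runs (SameCluster ''q'' (Elem ''S'' (Var ''t'')) (Elem ''rep'' (Var ''j'')) ;;
        Assign ''j'' (Sub (Add (Var ''j'') (Num 1)) (Var ''q''))) st' 3
        (\<lambda>st''. I st'' \<and> (length ?R - nvar st'' ''j'') + (1 - nvar st'' ''q'')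
          < (length ?R - nvar st' ''j'') + (1 - nvar st' ''q''))"
      using assms by (intro runs_straight) (auto simp: I_def less_Suc_eq)
  qed (use assms(1,2) in simp)
  then show ?thesis
  proof (rule runs_weaken)
    fix st' assume st': "I st' \<and> \<not> bval (Conj (Less (Var ''j'') (Var ''r'')) (Less (Var ''q'') (Num 1))) st'"
    let ?j = "nvar st' ''j''"
    from st' have I: "I st'" by blast
    have "nvar st' ''r'' = length ?R" using I assms(4) by (simp add: I_def)
    then have "?j < length ?R \<Longrightarrow> 1 \<le> nvar st' ''q''" using st' by simp
    then have exit: "?j < length ?R \<Longrightarrow> nvar st' ''q'' = 1" using I unfolding I_def by linarith
    have "takeWhile (\<lambda>x. \<not> same (S t) x) ?R = take ?j ?R"
      by (rule takeWhile_eq_take_P_nth) (use I exit in \<open>simp_all add: I_def\<close>)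
    then have "?j = name S t" using I by (simp add: name_def I_def)
    have "?j + nvar st' ''q'' \<le> length ?R"
      using I unfolding I_def by (cases "nvar st' ''q'' = 1") linarith+
    then have "queries st' \<le> queries st + length ?R" using I unfolding I_def by linarith
    with \<open>?j = name S t\<close> show "(\<forall>x. x \<noteq> ''j'' \<and> x \<noteq> ''q'' \<longrightarrow> nvar st' x = nvar st x) \<and> arr st' = arr st \<and> rvar st' = rvar st
       \<and> nvar st' ''j'' = name S t \<and> queries st' \<le> queries st + length ?R"
      using I by (simp add: I_def)
  qed simp
qed

lemma runs_name_samples:
  assumes "nvar st ''t'' = 0" "nvar st ''r'' = 0" "nvar st ''m'' = m" "arr st ''S'' = S"
    and len: "\<And>t. t < m \<Longrightarrow> length (reps S t) \<le> k"
  shows "runs name_samples st (m * (5 * k + 21) + 1)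
    (\<lambda>st'. (\<forall>x. x \<notin> {''t'', ''r'', ''j'', ''q''} \<longrightarrow> nvar st' x = nvar st x) \<and>
       (\<forall>A. A \<notin> {''rep'', ''name''} \<longrightarrow> arr st' A = arr st A) \<and> rvar st' = rvar st \<and>
       (\<forall>i<m. arr st' ''name'' i = name S i) \<and> queries st' \<le> queries st + m * k)"
proof -
  define I where "I t st' \<longleftrightarrow>
    (\<forall>x. x \<notin> {''t'', ''r'', ''j'', ''q''} \<longrightarrow> nvar st' x = nvar st x) \<and>
    (\<forall>A. A \<notin> {''rep'', ''name''} \<longrightarrow> arr st' A = arr st A) \<and> rvar st' = rvar st \<and>
    nvar st' ''t'' = t \<and> nvar st' ''r'' = length (reps S t) \<and>
    (\<forall>i<length (reps S t). arr st' ''rep'' i = reps S t ! i) \<and>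
    (\<forall>i<t. arr st' ''name'' i = name S i) \<and> queries st' \<le> queries st + t * k" for t and st' :: store
  have loop: "runs name_samples st (m * (5 * k + 21) + 1) (I m)"
    unfolding name_samples_def
  proof (rule runs_for[where tc = "5 * k + 19"])
    show "I 0 st" using assms by (simp add: I_def)
  next
    fix t st1 assume t: "t < m" and st1: "I t st1"
    define J where "J st' \<longleftrightarrow> (\<forall>x. x \<noteq> ''j'' \<and> x \<noteq> ''q'' \<longrightarrow> nvar st' x = nvar st1 x) \<and> arr st' = arr st1
      \<and> rvar st' = rvar st1 \<and> queries st' = queries st1 \<and> nvar st' ''j'' = 0 \<and> nvar st' ''q'' = 0" for st' :: store
    let ?tail = "Cond (Less (Var ''j'') (Var ''r'')) Skip
        (Store ''rep'' (Var ''r'') (Elem ''S'' (Var ''t'')) ;; Assign ''r'' (Add (Var ''r'') (Num 1))) ;;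
      Store ''name'' (Var ''t'') (Var ''j'') ;; Assign ''t'' (Add (Var ''t'') (Num 1))"
    have "runs ((Assign ''j'' (Num 0) ;; Assign ''q'' (Num 0)) ;; find_rep ;; ?tail) st1 (5 * k + 19) (I (Suc t))"
    proof (rule runs_Seq[where P = J and ?t1.0 = 3])
      show "runs (Assign ''j'' (Num 0) ;; Assign ''q'' (Num 0)) st1 3 J"
        by (rule runs_straight) (simp_all add: J_def)
    next
      fix st2 assume st2: "J st2"
      show "runs (find_rep ;; ?tail) st2 (5 * length (reps S t) + 6 + 1 + 8) (I (Suc t))"
      proof (rule runs_Seq)
        show "runs find_rep st2 (5 * length (reps S t) + 6)
          (\<lambda>st'. (\<forall>x. x \<noteq> ''j'' \<and> x \<noteq> ''q'' \<longrightarrow> nvar st' x = nvar st2 x) \<and> arr st' = arr st2 \<and> rvar st' = rvar st2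
            \<and> nvar st' ''j'' = name S t \<and> queries st' \<le> queries st2 + length (reps S t))"
          by (rule runs_find_rep) (use st1 st2 assms(4) in \<open>simp_all add: I_def J_def\<close>)
      next
        fix st3 :: store assume st3: "(\<forall>x. x \<noteq> ''j'' \<and> x \<noteq> ''q'' \<longrightarrow> nvar st3 x = nvar st2 x) \<and> arr st3 = arr st2
          \<and> rvar st3 = rvar st2 \<and> nvar st3 ''j'' = name S t \<and> queries st3 \<le> queries st2 + length (reps S t)"
        \<comment> \<open>The program compares \<open>j\<close> with \<open>r\<close>, whereas
          \<open>reps\<close> asks whether some representative matches; both tests coincide.\<close>
        have new: "name S t < length (reps S t) \<longleftrightarrow> \<not> (\<forall>x\<in>set (reps S t). \<not> same (S t) x)"
          using name_le[of S t] name_eq_length_iff[of S t] by linarith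
        have q: "queries st3 \<le> queries st + Suc t * k"
          using st1 st2 st3 len[OF t] by (simp add: I_def J_def)
        have nvar3: "\<forall>x. x \<notin> {''t'', ''r'', ''j'', ''q''} \<longrightarrow> nvar st3 x = nvar st x"
          "nvar st3 ''t'' = t" "nvar st3 ''r'' = length (reps S t)" "nvar st3 ''j'' = name S t"
          using st1 st2 st3 by (simp_all add: I_def J_def)
        have arr3: "\<forall>A. A \<notin> {''rep'', ''name''} \<longrightarrow> arr st3 A = arr st A" "rvar st3 = rvar st"
          "arr st3 ''S'' = S"
          "\<forall>i<length (reps S t). arr st3 ''rep'' i = reps S t ! i" "\<forall>i<t. arr st3 ''name'' i = name S i"
          using st1 st2 st3 assms(4) by (simp_all add: I_def J_def)
        show "runs ?tail st3 8 (I (Suc t))"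
        proof (rule runs_straight)
          show "I (Suc t) (exec ?tail st3)"
          proof (cases "name S t < length (reps S t)")
            case True
            then have "reps S (Suc t) = reps S t" using new by auto
            then show ?thesis
              unfolding I_def using True q nvar3 arr3 by (simp add: less_Suc_eq del: reps.simps)
          next
            case False
            then have "reps S (Suc t) = reps S t @ [S t]" "name S t = length (reps S t)"
              using new name_le[of S t] by auto
            then show ?thesis
              unfolding I_def using q nvar3 arr3 by (simp add: less_Suc_eq nth_append del: reps.simps)
          qed
        qed simp_all
      qed simp
    qed (use len[OF t] in simp)
    then show "bval (Less (Var ''t'') (Var ''m'')) st1 \<and>
      runs ((Assign ''j'' (Num 0) ;; Assign ''q'' (Num 0)) ;; find_rep ;; ?tail) st1 (5 * k + 19) (I (Suc t))"
      using t st1 assms(3) by (simp add: I_def)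
  next
    fix st' assume "I m st'"
    then show "\<not> bval (Less (Var ''t'') (Var ''m'')) st'" using assms(3) by (simp add: I_def)
  qed simp
  show ?thesis by (rule runs_weaken[OF loop]) (simp_all add: I_def)
qed

definition score_term :: "(nat \<Rightarrow> nat) \<Rightarrow> (nat \<Rightarrow> nat) \<Rightarrow> nat \<Rightarrow> nat \<Rightarrow> nat \<Rightarrow> real" where
  "score_term S h v j t = (if sample_colour S h (start v) t = j then sign_label lab v (S t) else 0)"

definition at_vertex :: "(nat \<Rightarrow> nat) \<Rightarrow> (nat \<Rightarrow> nat) \<Rightarrow> nat \<Rightarrow> store \<Rightarrow> bool" where
  "at_vertex S h v st \<longleftrightarrow>
     nvar st ''v'' = v \<and> nvar st ''b'' = start v \<and> nvar st ''off'' = off v \<and> nvar st ''s'' = s \<and>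
     nvar st ''k'' = k \<and> arr st ''S'' = S \<and> arr st ''out'' = h \<and>
     (\<forall>t<off v + s. arr st ''name'' t = name S t)"

lemma runs_compute_score:
  assumes "at_vertex S h v st" "nvar st ''j'' = j" "nvar st ''t'' = off v" "rvar st ''sc'' = 0"
  shows "runs compute_score st (13 * s + 1)
    (\<lambda>st'. (\<forall>x. x \<notin> {''t'', ''u'', ''c'', ''y''} \<longrightarrow> nvar st' x = nvar st x) \<and> arr st' = arr st \<and>
       (\<forall>x. x \<noteq> ''sc'' \<longrightarrow> rvar st' x = rvar st x) \<and> queries st' = queries st \<and>
       rvar st' ''sc'' = score S h v j)"
proof -
  define I where "I i st' \<longleftrightarrow>
    (\<forall>x. x \<notin> {''t'', ''u'', ''c'', ''y''} \<longrightarrow> nvar st' x = nvar st x) \<and> arr st' = arr st \<and>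
    (\<forall>x. x \<noteq> ''sc'' \<longrightarrow> rvar st' x = rvar st x) \<and> queries st' = queries st \<and>
    nvar st' ''t'' = off v + i \<and> rvar st' ''sc'' = (\<Sum>t\<in>{off v..<off v + i}. score_term S h v j t)"
    for i and st' :: store
  have loop: "runs compute_score st (13 * s + 1) (I s)"
    unfolding compute_score_def
  proof (rule runs_for[where tc = 11 and I = I])
    show "I 0 st" using assms by (simp add: I_def)
  next
    fix i st1 assume i: "i < s" and st1: "I i st1"
    let ?body = "Assign ''u'' (Elem ''S'' (Var ''t'')) ;;
        Cond (Less (Var ''u'') (Var ''b''))
          (Assign ''c'' (Elem ''out'' (Var ''u''))) (Assign ''c'' (Elem ''name'' (Var ''t''))) ;;
        Cond (Conj (nat_eq (Var ''c'') (Var ''j'')) (Neg (nat_eq (Var ''u'') (Var ''v''))))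
          (Label ''y'' (Var ''v'') (Var ''u'') ;;
           RAssign ''sc'' (RAdd (RVar ''sc'') (RSub (OfNat (Add (Var ''y'') (Var ''y''))) (OfNat (Num 1)))))
          Skip ;;
        Assign ''t'' (Add (Var ''t'') (Num 1))"
    let ?t = "off v + i"
    have vals: "nvar st1 ''t'' = ?t" "nvar st1 ''v'' = v" "nvar st1 ''b'' = start v" "nvar st1 ''j'' = j"
      "arr st1 ''S'' = S" "arr st1 ''out'' = h" "arr st1 ''name'' ?t = name S ?t"
      "nvar st1 ''off'' = off v" "nvar st1 ''s'' = s"
      using st1 assms i by (simp_all add: I_def at_vertex_def)
    have sum: "(\<Sum>t\<in>{off v..<off v + Suc i}. score_term S h v j t)
        = rvar st1 ''sc'' + score_term S h v j ?t"
      using st1 by (simp add: I_def)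
    have "runs ?body st1 11 (I (Suc i))"
    proof (rule runs_straight)
      have "I (Suc i) (exec ?body st1)
          \<longleftrightarrow> rvar (exec ?body st1) ''sc'' = rvar st1 ''sc'' + score_term S h v j ?t"
        unfolding I_def sum using st1 by (simp add: I_def)
      also have "\<dots>"
        using vals by (simp add: score_term_def sample_colour_def sign_label_def)
      finally show "I (Suc i) (exec ?body st1)" by simp
    qed simp_all
    then show "bval (Less (Var ''t'') (Add (Var ''off'') (Var ''s''))) st1 \<and> runs ?body st1 11 (I (Suc i))"
      using vals i by simp
  next
    fix st' assume "I s st'"
    then show "\<not> bval (Less (Var ''t'') (Add (Var ''off'') (Var ''s''))) st'"
      using assms by (simp add: I_def at_vertex_def)
  qed simp
  show ?thesis
    by (rule runs_weaken[OF loop]) (simp_all add: I_def score_def score_term_def)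
qed

lemma runs_choose_colour:
  assumes "at_vertex S h v st" "nvar st ''j'' = 0" "k \<ge> 1"
  shows "runs choose_colour st (k * (13 * s + 14) + 1)
    (\<lambda>st'. (\<forall>x. x \<notin> {''t'', ''u'', ''c'', ''y'', ''j'', ''best''} \<longrightarrow> nvar st' x = nvar st x) \<and> arr st' = arr st \<and>
       (\<forall>x. x \<notin> {''sc'', ''bs''} \<longrightarrow> rvar st' x = rvar st x) \<and> queries st' = queries st \<and>
       nvar st' ''best'' = best (score S h v) k)"
proof -
  let ?f = "score S h v"
  \<comment> \<open>The guard \<open>0 < j\<close> accounts for \<open>best\<close> and
    \<open>bs\<close> still holding arbitrary values before the first colour.\<close>
  define I where "I j st' \<longleftrightarrow>
    (\<forall>x. x \<notin> {''t'', ''u'', ''c'', ''y'', ''j'', ''best''} \<longrightarrow> nvar st' x = nvar st x) \<and> arr st' = arr st \<and>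
    (\<forall>x. x \<notin> {''sc'', ''bs''} \<longrightarrow> rvar st' x = rvar st x) \<and> queries st' = queries st \<and> nvar st' ''j'' = j \<and>
    (0 < j \<longrightarrow> nvar st' ''best'' = best ?f j \<and> rvar st' ''bs'' = ?f (best ?f j))" for j and st' :: store
  have loop: "runs choose_colour st (k * (13 * s + 14) + 1) (I k)"
    unfolding choose_colour_def
  proof (rule runs_for[where tc = "13 * s + 12" and I = I])
    show "I 0 st" using assms by (simp add: I_def)
  next
    fix j st1 assume j: "j < k" and st1: "I j st1"
    let ?pre = "RAssign ''sc'' (OfNat (Num 0)) ;; Assign ''t'' (Var ''off'')"
    let ?post = "Cond (Neg (Conj (Less (Num 0) (Var ''j'')) (Neg (RLess (RVar ''bs'') (RVar ''sc'')))))
           (Assign ''best'' (Var ''j'') ;; RAssign ''bs'' (RVar ''sc'')) Skip ;;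
         Assign ''j'' (Add (Var ''j'') (Num 1))"
    have av: "at_vertex S h v st1"
      using st1 assms(1) by (simp add: I_def at_vertex_def)
    have "runs (?pre ;; compute_score ;; ?post) st1 (3 + 1 + ((13 * s + 1) + 1 + 6)) (I (Suc j))"
    proof (rule runs_Seq[OF _ _ order_refl])
      show "runs ?pre st1 3 (\<lambda>st'. st' = exec ?pre st1)" by (rule runs_straight) simp_all
    next
      fix st2 assume st2: "st2 = exec ?pre st1"
      have av2: "at_vertex S h v st2" "nvar st2 ''j'' = j" "nvar st2 ''t'' = off v" "rvar st2 ''sc'' = 0"
        using av st1 by (simp_all add: st2 at_vertex_def I_def)
      show "runs (compute_score ;; ?post) st2 ((13 * s + 1) + 1 + 6) (I (Suc j))"
      proof (rule runs_Seq[OF runs_compute_score[OF av2] _ order_refl])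
        fix st3 :: store
        assume st3: "(\<forall>x. x \<notin> {''t'', ''u'', ''c'', ''y''} \<longrightarrow> nvar st3 x = nvar st2 x) \<and> arr st3 = arr st2 \<and>
          (\<forall>x. x \<noteq> ''sc'' \<longrightarrow> rvar st3 x = rvar st2 x) \<and> queries st3 = queries st2 \<and>
          rvar st3 ''sc'' = score S h v j"
        have frame: "\<forall>x. x \<notin> {''t'', ''u'', ''c'', ''y'', ''j'', ''best''} \<longrightarrow> nvar st3 x = nvar st x"
          "arr st3 = arr st" "\<forall>x. x \<notin> {''sc'', ''bs''} \<longrightarrow> rvar st3 x = rvar st x"
          "queries st3 = queries st" "nvar st3 ''j'' = j" "rvar st3 ''sc'' = ?f j"
          "0 < j \<Longrightarrow> nvar st3 ''best'' = best ?f j \<and> rvar st3 ''bs'' = ?f (best ?f j)"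
          using st1 st3 by (simp_all add: st2 I_def)
        show "runs ?post st3 6 (I (Suc j))"
        proof (rule runs_straight)
          show "I (Suc j) (exec ?post st3)"
          proof (cases "0 < j")
            case True
            from frame(7)[OF True] True show ?thesis
              unfolding I_def using frame(1-6) by simp
          next
            case False
            then show ?thesis unfolding I_def using frame(1-6) by simp
          qed
        qed simp_all
      qed
    qed
    moreover have "3 + 1 + ((13 * s + 1) + 1 + 6) = 13 * s + 12" by simp
    moreover have "bval (Less (Var ''j'') (Var ''k'')) st1"
      using j st1 av by (simp add: I_def at_vertex_def)
    ultimately show "bval (Less (Var ''j'') (Var ''k'')) st1 \<and>
        runs (?pre ;; compute_score ;; ?post) st1 (13 * s + 12) (I (Suc j))" by metis
  next
    fix st' assume "I k st'"
    then show "\<not> bval (Less (Var ''j'') (Var ''k'')) st'"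
      using assms(1) by (simp add: I_def at_vertex_def)
  qed simp
  show ?thesis
    by (rule runs_weaken[OF loop]) (use assms(3) in \<open>simp_all add: I_def\<close>)
qed

lemma runs_colour_vertices:
  assumes "nvar st ''v'' = 0" "nvar st ''b'' = 0" "nvar st ''off'' = 0" "nvar st ''s'' = s"
    "nvar st ''n'' = n" "nvar st ''k'' = k" "arr st ''S'' = S" "arr st ''out'' = (\<lambda>_. 0)"
    "rvar st ''eps'' / 16 = \<eta>" "k \<ge> 1" "\<eta> > 0"
    and name: "\<And>v t. v < n \<Longrightarrow> t < off v + s \<Longrightarrow> arr st ''name'' t = name S t"
  shows "runs colour_vertices st (n * (k * (13 * s + 14) + 14) + 1)
    (\<lambda>st'. arr st' ''out'' = out S n \<and> queries st' = queries st)"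
proof -
  \<comment> \<open>The block is updated on arrival at a vertex, so before vertex \<open>v\<close>
    the program still holds the block of \<open>v - 1\<close>. At \<open>v = 0\<close> truncation
    gives \<open>block 0\<close>, and the test for a new block fails.\<close>
  define I where "I v st' \<longleftrightarrow>
    nvar st' ''v'' = v \<and> (nvar st' ''b'', nvar st' ''off'') = block (v - 1) \<and>
    (\<forall>x\<in>{''s'', ''n'', ''k''}. nvar st' x = nvar st x) \<and>
    (\<forall>A. A \<noteq> ''out'' \<longrightarrow> arr st' A = arr st A) \<and> arr st' ''out'' = out S v \<and>
    rvar st' ''eps'' = rvar st ''eps'' \<and> queries st' = queries st" for v and st' :: store
  let ?T = "k * (13 * s + 14) + 1"
  have loop: "runs colour_vertices st (n * (k * (13 * s + 14) + 14) + 1) (I n)"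
    unfolding colour_vertices_def
  proof (rule runs_for[where tc = "k * (13 * s + 14) + 12" and I = I])
    show "I 0 st" using assms by (simp add: I_def)
  next
    fix v st1 assume v: "v < n" and st1: "I v st1"
    let ?pre = "Cond (RLess (RMul (RDiv (RVar ''eps'') (OfNat (Num 16))) (OfNat (Var ''n''))) (OfNat (Sub (Var ''v'') (Var ''b''))))
           (Assign ''b'' (Var ''v'') ;; Assign ''off'' (Add (Var ''off'') (Var ''s''))) Skip ;;
         Assign ''j'' (Num 0)"
    let ?post = "Store ''out'' (Var ''v'') (Var ''best'') ;; Assign ''v'' (Add (Var ''v'') (Num 1))"
    have "runs (?pre ;; choose_colour ;; ?post) st1 (6 + 1 + (?T + 1 + 3)) (I (Suc v))"
    proof (rule runs_Seq[OF _ _ order_refl])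
      show "runs ?pre st1 6 (\<lambda>st'. st' = exec ?pre st1)" by (rule runs_straight) simp_all
    next
      fix st2 assume st2: "st2 = exec ?pre st1"
      have "nvar st2 ''b'' = start v \<and> nvar st2 ''off'' = off v"
      proof (cases v)
        case 0
        have "\<not> \<eta> * real n < 0" using assms(11) by (simp add: not_less)
        with 0 show ?thesis using st1 assms by (simp add: st2 I_def)
      next
        case (Suc w)
        then have "nvar st1 ''b'' = start w" "nvar st1 ''off'' = off w"
          using st1 by (simp_all add: I_def prod_eq_iff)
        then show ?thesis using Suc st1 assms by (simp add: st2 I_def)
      qed
      then have av: "at_vertex S (out S v) v st2" "nvar st2 ''j'' = 0"
        using st1 assms name[OF v] by (simp_all add: st2 at_vertex_def I_def)
      have fr2: "\<forall>x\<in>{''s'', ''n'', ''k''}. nvar st2 x = nvar st x" "\<forall>A. A \<noteq> ''out'' \<longrightarrow> arr st2 A = arr st A"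
        "rvar st2 ''eps'' = rvar st ''eps''" "queries st2 = queries st"
        using st1 by (simp_all add: st2 I_def)
      show "runs (choose_colour ;; ?post) st2 (?T + 1 + 3) (I (Suc v))"
      proof (rule runs_Seq[OF runs_choose_colour[OF av assms(10)] _ order_refl])
        fix st3 :: store
        assume st3: "(\<forall>x. x \<notin> {''t'', ''u'', ''c'', ''y'', ''j'', ''best''} \<longrightarrow> nvar st3 x = nvar st2 x) \<and> arr st3 = arr st2 \<and>
          (\<forall>x. x \<notin> {''sc'', ''bs''} \<longrightarrow> rvar st3 x = rvar st2 x) \<and> queries st3 = queries st2 \<and>
          nvar st3 ''best'' = best (score S (out S v) v) k"
        have "nvar st3 ''v'' = v" "nvar st3 ''b'' = start v" "nvar st3 ''off'' = off v"
          "arr st3 ''out'' = out S v"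
          using av(1) st3 by (simp_all add: at_vertex_def)
        then show "runs ?post st3 3 (I (Suc v))"
          using st3 fr2 by (intro runs_straight) (simp_all add: I_def)
      qed
    qed
    moreover have "6 + 1 + (?T + 1 + 3) = k * (13 * s + 14) + 12" by simp
    moreover have "bval (Less (Var ''v'') (Var ''n'')) st1"
      using v st1 assms by (simp add: I_def)
    ultimately show "bval (Less (Var ''v'') (Var ''n'')) st1 \<and>
        runs (?pre ;; choose_colour ;; ?post) st1 (k * (13 * s + 14) + 12) (I (Suc v))" by metis
  next
    fix st' assume "I n st'"
    then show "\<not> bval (Less (Var ''v'') (Var ''n'')) st'" using assms by (simp add: I_def)
  qed simp
  show ?thesis by (rule runs_weaken[OF loop]) (simp_all add: I_def)
qed

end


section \<open>Correctness and complexity\<close>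

text \<open>Applied with \<open>A\<close> the event of few bad vertices, on which the rest of the
  program succeeds surely.\<close>

lemma prob_le_prob_bind_pmf:
  assumes "\<And>x y. x \<in> set_pmf M \<Longrightarrow> x \<in> A \<Longrightarrow> y \<in> set_pmf (N x) \<Longrightarrow> y \<in> E"
  shows "measure_pmf.prob M A \<le> measure_pmf.prob (bind_pmf M N) E"
proof -
  have "measure_pmf.prob M A = measure_pmf.expectation M (indicator A)" by simp
  also have "\<dots> \<le> measure_pmf.expectation M (\<lambda>x. measure_pmf.prob (N x) E)"
  proof (intro integral_mono_AE measure_pmf.integrable_const_bound[where B = 1] AE_pmfI)
    fix x assume x: "x \<in> set_pmf M"
    show "indicator A x \<le> measure_pmf.prob (N x) E"
    proof (cases "x \<in> A")
      case True
      then have "measure_pmf.prob (N x) E = 1"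
        using assms[OF x] by (subst measure_pmf.prob_eq_1) (auto simp: AE_measure_pmf_iff)
      then show ?thesis by (simp add: indicator_def)
    qed simp
  qed (auto simp: indicator_def)
  finally show ?thesis by (simp add: prob_bind_pmf)
qed

lemma out_clustering_Pair:
  "out_clustering n (c, st) = (\<lambda>v. {u \<in> {..<n}. arr st ''out'' u = arr st ''out'' v}) ` {..<n}"
  by (simp add: out_clustering_def)

lemma clustering_colour_classes:
  assumes "\<And>u. u < n \<Longrightarrow> h u < k"
  shows "clustering n k ((\<lambda>v. {u \<in> {..<n}. h u = h v}) ` {..<n})"
proof -
  have "(\<lambda>v. {u \<in> {..<n}. h u = h v}) ` {..<n} = (\<lambda>j. {u \<in> {..<n}. h u = j}) ` h ` {..<n}"
    by (simp add: image_image)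
  moreover have "card ((\<lambda>j. {u \<in> {..<n}. h u = j}) ` h ` {..<n}) \<le> card (h ` {..<n})"
    by (rule card_image_le) simp
  moreover have "card (h ` {..<n}) \<le> card {..<k}"
    by (rule card_mono) (use assms in auto)
  ultimately have "card ((\<lambda>v. {u \<in> {..<n}. h u = h v}) ` {..<n}) \<le> k" by simp
  moreover have "partition_on {..<n} ((\<lambda>v. {u \<in> {..<n}. h u = h v}) ` {..<n})"
    by (auto simp: partition_on_def disjoint_def)
  ultimately show ?thesis by (simp add: clustering_def)
qed

lemma agreements_colour_classes:
  "real (agreements n L ((\<lambda>v. {u \<in> {..<n}. h u = h v}) ` {..<n})) = colour_agreements n L h"
  by (rule agreements_eq_colour_agreements) auto

definition query_max_ag_time :: "nat \<Rightarrow> nat \<Rightarrow> nat \<Rightarrow> nat \<Rightarrow> nat \<Rightarrow> nat" where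
  "query_max_ag_time n k l s m =
     (5 * l + 3 * s + 7) + 1 + ((m * 7 + 1) + 1 +
       ((m * (5 * k + 21) + 1) + 1 + (n * (k * (13 * s + 14) + 14) + 1)))"

definition good_output :: "real \<Rightarrow> nat \<Rightarrow> nat \<Rightarrow> labelling \<Rightarrow> nat set set \<Rightarrow> bool" where
  "good_output \<epsilon> k n L P \<longleftrightarrow>
     clustering n k P \<and> real (agreements n L P) \<ge> real (OPT n k L) - \<epsilon> * real n ^ 2 / 2"

locale instance_parameters =
  fixes \<epsilon> \<delta> :: real and k n :: nat and L :: labelling and D :: "nat set set" and l s m :: nat
  assumes pos: "\<epsilon> > 0" "\<delta> > 0" "k \<ge> 1" "n \<ge> 1" and opt: "optimal_clustering n k L D"
  defines "l \<equiv> log_size (64 * real k / (\<epsilon> * \<delta>))"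
    and "s \<equiv> sample_size \<epsilon> l"
    and "m \<equiv> sample_number \<epsilon> s"
begin

sublocale greedy "edge_label n L" "same_cluster D" n k s "\<epsilon> / 16" .

lemma D: "partition_on {..<n} D" "card D \<le> k" "finite D"
  using opt finite_elements by (auto simp: optimal_clustering_def clustering_def)

lemma l_ge: "l \<ge> 1" "64 * real k / (\<epsilon> * \<delta>) \<le> 2 ^ l"
proof -
  show "l \<ge> 1" by (simp add: l_def log_size_def)
  have "log 2 (64 * real k / (\<epsilon> * \<delta>)) \<le> l"
    unfolding l_def log_size_def by linarith
  then show "64 * real k / (\<epsilon> * \<delta>) \<le> 2 ^ l"
    using pos by (simp add: log_le_iff powr_realpow)
qed

lemma s_ge: "512 * real l / (\<epsilon> * \<epsilon>) \<le> s" "s \<ge> 1"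
proof -
  show *: "512 * real l / (\<epsilon> * \<epsilon>) \<le> s"
    unfolding s_def sample_size_def using real_nat_ceiling_ge by simp
  have "0 < 512 * real l / (\<epsilon> * \<epsilon>)" using l_ge pos by simp
  with * have "real s > 0" by linarith
  then show "s \<ge> 1" by simp
qed

lemma m_ge: "(1 / (\<epsilon> / 16) + 1) * s \<le> m"
  unfolding m_def sample_number_def using real_nat_ceiling_ge[of "(16 / \<epsilon> + 1) * real s"] by simp

text \<open>The choice of \<open>s\<close> makes the Hoeffding exponent at least \<open>l\<close>,
  and \<open>exp l\<close> is at least \<open>2 ^ l\<close>, hence at least
  \<open>64 * k / (\<epsilon> * \<delta>)\<close>. This is what turns the Markov bound into
  \<open>\<delta>\<close>.\<close>

lemma prob_few_bad:
  "1 - \<delta> \<le> measure_pmf.prob (uniform_sample n {..<m})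
     {S. card {v. v < n \<and> \<not> good D S v} < \<epsilon> / 16 * n}"
proof -
  let ?M = "measure_pmf (uniform_sample n {..<m})"
  let ?A = "{S. \<epsilon> / 16 * n \<le> card {v. v < n \<and> \<not> good D S v}}"
  have "2 ^ l \<le> (exp 1 :: real) ^ l" using exp_ge_add_one_self[of 1] by (intro power_mono) auto
  also have "\<dots> = exp l" by (simp add: exp_of_nat_mult[symmetric])
  also have "\<dots> \<le> exp (s * (\<epsilon> / 16)\<^sup>2 / 2)"
    using s_ge(1) pos by (simp add: field_simps power2_eq_square)
  finally have "64 * real k / (\<epsilon> * \<delta>) \<le> exp (s * (\<epsilon> / 16)\<^sup>2 / 2)" using l_ge(2) by linarith
  then have "4 * k * exp (- (s * (\<epsilon> / 16)\<^sup>2 / 2)) / (\<epsilon> / 16) \<le> \<delta>"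
    using pos by (simp add: exp_minus field_simps)
  then have "measure ?M ?A \<le> \<delta>"
    using prob_many_not_good[OF pos(4) s_ge(2) _ m_ge D(3,2)] pos by simp
  moreover have "UNIV - ?A = {S. card {v. v < n \<and> \<not> good D S v} < \<epsilon> / 16 * n}" by auto
  ultimately show ?thesis using measure_pmf.prob_compl[of ?A "uniform_sample n {..<m}"] by simp
qed

lemma good_output_if_few_bad:
  assumes "\<And>t. t < m \<Longrightarrow> S t < n" "card {v. v < n \<and> \<not> good D S v} < \<epsilon> / 16 * n"
  shows "good_output \<epsilon> k n L ((\<lambda>v. {u \<in> {..<n}. out S n u = out S n v}) ` {..<n})"
proof -
  obtain c where c: "\<And>u. u < n \<Longrightarrow> c u < k"
    "\<And>u v. u < n \<Longrightarrow> v < n \<Longrightarrow> c u = c v \<longleftrightarrow> same_cluster D u v"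
    "\<And>t. t < m \<Longrightarrow> c (S t) = name S t"
    using cluster_colouring[where D = D and m = m and S = S, OF D(1,2) refl assms(1)] by metis
  have samples: "S t < n \<and> name S t = c (S t)" if "v < n" "t < off v + s" for v t
  proof -
    have "real (off v + s) \<le> real m" using off_bound[OF _ that(1)] m_ge pos by fastforce
    with that(2) have "t < m" by linarith
    then show ?thesis using assms(1) c(3) by simp
  qed
  have "colour_agreements n L (out S n) \<ge> colour_agreements n L c - 6 * (\<epsilon> / 16) * n * n
      - n * card {v. v < n \<and> \<not> good D S v}"
    by (rule greedy_loss[OF D(1) pos(3,4) s_ge(2) _ c(1,2) samples refl]) (use pos in auto)
  moreover have "real n * real (card {v. v < n \<and> \<not> good D S v}) \<le> n * (\<epsilon> / 16 * n)"
    using assms(2) by (intro mult_left_mono) auto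
  moreover have "colour_agreements n L c = OPT n k L"
    using agreements_eq_colour_agreements[of n c D L] c(2) opt
    by (simp add: same_cluster_def optimal_clustering_def)
  \<comment> \<open>Both losses together are 7/16 of \<open>\<epsilon> * n * n\<close>;
    nonnegativity allows 8/16.\<close>
  moreover have "0 \<le> \<epsilon> * (real n * n)" using pos by simp
  ultimately have "colour_agreements n L (out S n) \<ge> OPT n k L - \<epsilon> * real n ^ 2 / 2"
    by (simp add: power2_eq_square mult_ac)
  then show ?thesis
    unfolding good_output_def agreements_colour_classes
    using clustering_colour_classes[of n "out S n" k] out_less[OF pos(3)] by simp
qed

text \<open>The array of samples has the uniform law from whatever store \<open>set_sizes\<close>
  ends in, and given this array the remaining phases force the output. So the success probability is
  at least that of an event about the samples.\<close>

lemma query_max_ag_result: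
  obtains M where
    "halts_with query_max_ag (init_store \<epsilon> \<delta> k n) (query_max_ag_time n k l s m) M"
    "\<forall>st\<in>set_pmf M. queries st \<le> m * k"
    "1 - \<delta> \<le> measure_pmf.prob M {st. good_output \<epsilon> k n L (out_clustering n (Skip, st))}"
proof -
  let ?init = "init_store \<epsilon> \<delta> k n" and ?U = "uniform_sample n {..<m}"
  let ?T1 = "5 * l + 3 * s + 7" and ?T2 = "m * 7 + 1"
  let ?T3 = "(m * (5 * k + 21) + 1) + 1 + (n * (k * (13 * s + 14) + 14) + 1)"
  let ?rest = "name_samples ;; colour_vertices"
  define P0 where "P0 st \<longleftrightarrow> (\<forall>x. x \<noteq> ''l'' \<and> x \<noteq> ''s'' \<longrightarrow> nvar st x = nvar ?init x)
    \<and> nvar st ''s'' = s \<and> arr st = (\<lambda>_ _. 0) \<and> rvar st ''eps'' = \<epsilon> \<and> queries st = 0" for st :: store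
  have "runs set_sizes ?init ?T1 P0"
    using runs_set_sizes[OF pos(1-3), of n] unfolding P0_def l_def[symmetric] s_def[symmetric] .
  then obtain M0 where M0: "halts_with set_sizes ?init ?T1 M0" "\<And>st. st \<in> set_pmf M0 \<Longrightarrow> P0 st"
    by (auto simp: runs_def)
  define P1 where "P1 st \<longleftrightarrow> nvar st ''m'' = m \<and>
    (\<forall>x\<in>{''t'', ''r'', ''v'', ''b'', ''off''}. nvar st x = 0) \<and> nvar st ''s'' = s \<and> nvar st ''n'' = n \<and>
    nvar st ''k'' = k \<and> arr st ''out'' = (\<lambda>_. 0) \<and> rvar st ''eps'' = \<epsilon> \<and> queries st = 0" for st :: store
  have "\<exists>M. halts_with draw_samples st ?T2 M \<and> map_pmf (\<lambda>st'. arr st' ''S'') M = ?U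
      \<and> (\<forall>st'\<in>set_pmf M. P1 st')" if "st \<in> set_pmf M0" for st
  proof -
    have st: "P0 st" using M0(2) that by blast
    have "\<And>i. real i < (16 / \<epsilon> + 1) * s \<longleftrightarrow> i < m"
      unfolding m_def sample_number_def by (rule less_nat_ceiling_iff)
    then obtain M where M: "halts_with draw_samples st ((m - 0) * 7 + 1) M"
      "map_pmf (\<lambda>st'. arr st' ''S'') M = map_pmf (\<lambda>g t. if t \<in> {0..<m} then g t else 0) (uniform_sample n {0..<m})"
      "\<And>st'. st' \<in> set_pmf M \<Longrightarrow> (\<forall>x. x \<noteq> ''m'' \<and> x \<noteq> ''u'' \<longrightarrow> nvar st' x = nvar st x) \<and> nvar st' ''m'' = m \<and>
        (\<forall>A. A \<noteq> ''S'' \<longrightarrow> arr st' A = arr st A) \<and> rvar st' = rvar st \<and> queries st' = queries st"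
      using halts_with_draw_samples[of n "(16 / \<epsilon> + 1) * real s" m 0 st "\<lambda>_. 0"] pos(4) st
      by (auto simp: P0_def init_store_def)
    \<comment> \<open>Outside the index set \<open>Pi_pmf\<close> takes its default value 0, like
      the cells of the initial array.\<close>
    have "map_pmf (\<lambda>g t. if t \<in> {0..<m} then g t else 0) (uniform_sample n {0..<m}) = map_pmf (\<lambda>g. g) ?U"
      unfolding lessThan_atLeast0
      using set_Pi_pmf_subset[of "{0..<m}" 0 "\<lambda>_. pmf_of_set {0..<n}"]
      by (intro map_pmf_cong refl) (auto simp: fun_eq_iff)
    then have "map_pmf (\<lambda>st'. arr st' ''S'') M = ?U" using M(2) by simp
    moreover have "P1 st'" if "st' \<in> set_pmf M" for st'
      using M(3)[OF that] st by (simp add: P0_def P1_def init_store_def)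
    ultimately show ?thesis using M(1) by auto
  qed
  then have "\<exists>M1. \<forall>st\<in>set_pmf M0. halts_with draw_samples st ?T2 (M1 st)
      \<and> map_pmf (\<lambda>st'. arr st' ''S'') (M1 st) = ?U \<and> (\<forall>st'\<in>set_pmf (M1 st). P1 st')"
    by (intro bchoice) blast
  then obtain M1 where M1: "\<And>st. st \<in> set_pmf M0 \<Longrightarrow> halts_with draw_samples st ?T2 (M1 st)"
    "\<And>st. st \<in> set_pmf M0 \<Longrightarrow> map_pmf (\<lambda>st'. arr st' ''S'') (M1 st) = ?U"
    "\<And>st st'. st \<in> set_pmf M0 \<Longrightarrow> st' \<in> set_pmf (M1 st) \<Longrightarrow> P1 st'"
    by blast
  have sample_less: "S t < n" if "S \<in> set_pmf ?U" "t < m" for S t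
    using that pos(4) set_Pi_pmf_subset'[of "{..<m}" 0 "\<lambda>_. pmf_of_set {..<n}"]
    by (fastforce simp: PiE_dflt_def lessThan_empty_iff)
  define Q where "Q st st' \<longleftrightarrow> arr st' ''out'' = out (arr st ''S'') n \<and> queries st' \<le> m * k"
    for st st' :: store
  have rest: "runs ?rest st ?T3 (Q st)" if st: "P1 st" and S: "arr st ''S'' \<in> set_pmf ?U" for st
  proof -
    let ?S = "arr st ''S''"
    have len: "length (reps ?S t) \<le> k" if "t < m" for t
      by (rule length_reps_le[OF D(1,2) refl]) (use sample_less[OF S] that in auto)
    have "runs name_samples st (m * (5 * k + 21) + 1)
      (\<lambda>st'. (\<forall>x. x \<notin> {''t'', ''r'', ''j'', ''q''} \<longrightarrow> nvar st' x = nvar st x) \<and>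
         (\<forall>A. A \<notin> {''rep'', ''name''} \<longrightarrow> arr st' A = arr st A) \<and> rvar st' = rvar st \<and>
         (\<forall>i<m. arr st' ''name'' i = name ?S i) \<and> queries st' \<le> queries st + m * k)"
      by (rule runs_name_samples) (use st len in \<open>simp_all add: P1_def\<close>)
    then show ?thesis
    proof (rule runs_Seq[OF _ _ order_refl])
      fix st' :: store assume st': "(\<forall>x. x \<notin> {''t'', ''r'', ''j'', ''q''} \<longrightarrow> nvar st' x = nvar st x) \<and>
         (\<forall>A. A \<notin> {''rep'', ''name''} \<longrightarrow> arr st' A = arr st A) \<and> rvar st' = rvar st \<and>
         (\<forall>i<m. arr st' ''name'' i = name ?S i) \<and> queries st' \<le> queries st + m * k"
      have "arr st' ''name'' t = name ?S t" if "v < n" "t < off v + s" for v t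
      proof -
        have "real (off v + s) \<le> real m" using off_bound[OF _ that(1)] m_ge pos by fastforce
        with that(2) have "t < m" by linarith
        then show ?thesis using st' by blast
      qed
      then have "runs colour_vertices st' (n * (k * (13 * s + 14) + 14) + 1)
          (\<lambda>st''. arr st'' ''out'' = out ?S n \<and> queries st'' = queries st')"
        using st st' pos by (intro runs_colour_vertices) (simp_all add: P1_def)
      then show "runs colour_vertices st' (n * (k * (13 * s + 14) + 14) + 1) (Q st)"
        by (rule runs_weaken) (use st st' in \<open>simp_all add: Q_def P1_def\<close>)
    qed
  qed
  \<comment> \<open>\<open>runs\<close> only asserts that a final law exists for each store; a
    choice turns this into the kernel that \<open>halts_with_Seq\<close> composes.\<close>
  define N where "N st = (SOME M. halts_with ?rest st ?T3 M \<and> (\<forall>st'\<in>set_pmf M. Q st st'))" for st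
  have N: "halts_with ?rest st1 ?T3 (N st1)" "\<And>st'. st' \<in> set_pmf (N st1) \<Longrightarrow> Q st1 st'"
    if "st \<in> set_pmf M0" "st1 \<in> set_pmf (M1 st)" for st st1
  proof -
    have "arr st1 ''S'' \<in> set_pmf (map_pmf (\<lambda>st'. arr st' ''S'') (M1 st))" using that(2) by simp
    then have "runs ?rest st1 ?T3 (Q st1)" using rest M1(2,3) that by metis
    then have "halts_with ?rest st1 ?T3 (N st1) \<and> (\<forall>st'\<in>set_pmf (N st1). Q st1 st')"
      unfolding runs_def N_def by (rule someI_ex)
    then show "halts_with ?rest st1 ?T3 (N st1)" "\<And>st'. st' \<in> set_pmf (N st1) \<Longrightarrow> Q st1 st'" by blast+
  qed
  let ?M = "bind_pmf M0 (\<lambda>st. bind_pmf (M1 st) N)"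
  let ?good = "{st. good_output \<epsilon> k n L (out_clustering n (Skip, st))}"
  show ?thesis
  proof (rule that)
    show "halts_with query_max_ag ?init (query_max_ag_time n k l s m) ?M"
      unfolding query_max_ag_def query_max_ag_time_def
      by (intro halts_with_Seq M0(1) M1(1) N(1))
    show "\<forall>st\<in>set_pmf ?M. queries st \<le> m * k"
      using N(2) by (auto simp: Q_def)
    show "1 - \<delta> \<le> measure_pmf.prob ?M ?good"
    proof (rule prob_bind_pmf_ge)
      fix st assume st: "st \<in> set_pmf M0"
      let ?few = "{S. card {v. v < n \<and> \<not> good D S v} < \<epsilon> / 16 * n}"
      have "1 - \<delta> \<le> measure_pmf.prob (map_pmf (\<lambda>st'. arr st' ''S'') (M1 st)) ?few"
        unfolding M1(2)[OF st] by (rule prob_few_bad)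
      also have "\<dots> = measure_pmf.prob (M1 st) ((\<lambda>st'. arr st' ''S'') -` ?few)" by simp
      also have "\<dots> \<le> measure_pmf.prob (bind_pmf (M1 st) N) ?good"
      proof (rule prob_le_prob_bind_pmf)
        fix st1 st2
        assume st1: "st1 \<in> set_pmf (M1 st)" "st1 \<in> (\<lambda>st'. arr st' ''S'') -` ?few" and st2: "st2 \<in> set_pmf (N st1)"
        have "arr st1 ''S'' \<in> set_pmf (map_pmf (\<lambda>st'. arr st' ''S'') (M1 st))" using st1(1) by simp
        then have "arr st1 ''S'' \<in> set_pmf ?U" unfolding M1(2)[OF st] .
        then have "good_output \<epsilon> k n L
            ((\<lambda>v. {u \<in> {..<n}. out (arr st1 ''S'') n u = out (arr st1 ''S'') n v}) ` {..<n})"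
          by (intro good_output_if_few_bad) (use st1(2) sample_less in auto)
        moreover have "arr st2 ''out'' = out (arr st1 ''S'') n" using N(2)[OF st st1(1) st2] by (simp add: Q_def)
        ultimately show "st2 \<in> ?good" by (simp add: out_clustering_Pair)
      qed
      finally show "1 - \<delta> \<le> measure_pmf.prob (bind_pmf (M1 st) N) ?good" .
    qed
  qed
qed

section \<open>Asymptotic size of the parameters\<close>

context
  assumes small: "\<epsilon> \<le> 1" "real k / (\<epsilon> ^ 2 * \<delta>) \<ge> 2"
begin

text \<open>As \<open>\<epsilon> \<le> 1\<close>, the argument of the logarithm is at most
  \<open>64 * ?K\<close>. The factor 64 adds 6, rounding up and the 1 in \<open>log_size\<close> add
  2, and 8 is at most \<open>8 * log 2 ?K\<close> because \<open>?K\<close> is at least 2. Passing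
  to \<open>ln\<close> at most doubles the resulting 9.\<close>

lemma l_le: "l \<le> 18 * ln (real k / (\<epsilon> ^ 2 * \<delta>))"
proof -
  let ?K = "real k / (\<epsilon> ^ 2 * \<delta>)"
  have K: "log 2 ?K \<ge> 1" using small(2) by (simp add: le_log_iff)
  have "64 * real k / (\<epsilon> * \<delta>) = 64 * ?K * \<epsilon>" using pos by (simp add: power2_eq_square field_simps)
  also have "\<dots> \<le> 64 * ?K * 1" using small by (intro mult_left_mono) auto
  finally have "log 2 (64 * real k / (\<epsilon> * \<delta>)) \<le> log 2 (64 * ?K)"
    using pos by (subst log_le_cancel_iff) auto
  also have "\<dots> = log 2 (2 ^ 6) + log 2 ?K" using small(2) log_mult_pos[of "2 ^ 6" ?K 2] by force
  also have "log 2 (2 ^ 6 :: real) = 6" by (subst log_pow_cancel) auto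
  finally have "l \<le> 8 + log 2 ?K" unfolding l_def log_size_def using K by linarith
  also have "\<dots> \<le> 9 * log 2 ?K" using K by simp
  also have "\<dots> = 9 * (ln ?K / ln 2)" by (simp add: log_def)
  also have "\<dots> \<le> 9 * (ln ?K / (1 / 2))"
    using ln_2_less_1 ln2_ge_two_thirds small(2) by (intro mult_left_mono divide_left_mono) auto
  finally show ?thesis by simp
qed

text \<open>Rounding up adds at most 1, which is at most \<open>l / \<epsilon> ^ 2\<close>.\<close>

lemma s_le: "s \<le> 513 * (real l / \<epsilon> ^ 2)"
proof -
  have "\<epsilon> ^ 2 \<le> 1" using pos small(1) by (simp add: power_le_one)
  then have "1 \<le> l / \<epsilon> ^ 2" using l_ge(1) pos by (simp add: le_divide_eq)
  moreover have "s \<le> 512 * (real l / \<epsilon> ^ 2) + 1"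
    unfolding s_def sample_size_def using \<open>1 \<le> l / \<epsilon> ^ 2\<close> by (simp add: power2_eq_square)
  ultimately show ?thesis by simp
qed

text \<open>The 16, the summand \<open>s\<close> and the rounding each count against
  \<open>s / \<epsilon>\<close> and give 18; then 9234 = 18 * 513.\<close>

lemma m_le: "m \<le> 9234 * (real l / \<epsilon> ^ 3)"
proof -
  have "1 \<le> s / \<epsilon>" "s \<le> s / \<epsilon>" using s_ge(2) pos small(1) by (simp_all add: le_divide_eq)
  moreover have "(16 / \<epsilon> + 1) * s = 16 * (s / \<epsilon>) + s" by (simp add: algebra_simps)
  ultimately have "m \<le> 18 * (s / \<epsilon>)" unfolding m_def sample_number_def by linarith
  also have "\<dots> \<le> 18 * (513 * (real l / \<epsilon> ^ 2) / \<epsilon>)"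
    using s_le pos by (intro mult_left_mono divide_right_mono) auto
  finally show ?thesis using pos by (simp add: power2_eq_square power3_eq_cube)
qed

lemma queries_le: "real (m * k) \<le> 7200000 * (real k / \<epsilon> ^ 3 * ln (real k / (\<epsilon> ^ 2 * \<delta>)))"
proof -
  have "real (m * k) \<le> 9234 * (real l / \<epsilon> ^ 3) * k"
    using mult_right_mono[OF m_le, of "real k"] by simp
  also have "\<dots> = 9234 * (real k / \<epsilon> ^ 3) * l" by simp
  also have "\<dots> \<le> 9234 * (real k / \<epsilon> ^ 3) * (18 * ln (real k / (\<epsilon> ^ 2 * \<delta>)))"
    using l_le pos by (intro mult_left_mono) auto
  also have "\<dots> = 166212 * (real k / \<epsilon> ^ 3 * ln (real k / (\<epsilon> ^ 2 * \<delta>)))" by simp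
  \<comment> \<open>The larger constant is the one forced by the running time, as both bounds share
    it.\<close>
  also have "\<dots> \<le> 7200000 * (real k / \<epsilon> ^ 3 * ln (real k / (\<epsilon> ^ 2 * \<delta>)))"
  proof -
    have "0 \<le> ln (real k / (\<epsilon> ^ 2 * \<delta>))" using small(2) by (intro ln_ge_zero) linarith
    then show ?thesis using pos by (intro mult_right_mono mult_nonneg_nonneg) auto
  qed
  finally show ?thesis .
qed

text \<open>Colouring takes order \<open>n * k * s\<close>, that is
  \<open>n * k * l / \<epsilon> ^ 2\<close>; the third power of \<open>1 / \<epsilon>\<close> stems
  from drawing and naming all \<open>m\<close> points. Every summand is compared with the single
  quantity \<open>W\<close>, and 7200000 = 18 * 400000.\<close>

lemma time_le:
  "real (query_max_ag_time n k l s m) \<le> 7200000 * (real n * real k / \<epsilon> ^ 3 * ln (real k / (\<epsilon> ^ 2 * \<delta>)))"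
proof -
  define W where "W = real n * real k * (real l / \<epsilon> ^ 3)"
  have \<epsilon>: "\<epsilon> ^ 3 \<le> \<epsilon> ^ 2" "\<epsilon> ^ 3 \<le> 1"
    using pos small(1) by (simp_all add: power_decreasing power_le_one)
  have e2: "l / \<epsilon> ^ 2 \<le> l / \<epsilon> ^ 3" using \<epsilon> pos by (intro divide_left_mono) auto
  have e0: "l \<le> l / \<epsilon> ^ 3" using \<epsilon> pos by (simp add: le_divide_eq mult_left_le)
  have e1: "1 \<le> l / \<epsilon> ^ 3" using e0 l_ge(1) by linarith
  have nk: "1 \<le> real n * real k" using pos by (simp add: mult_ge1_I)
  have W: "x \<le> W" if "x \<le> l / \<epsilon> ^ 3" for x
    using mult_right_mono[OF nk, of "l / \<epsilon> ^ 3"] e1 that by (simp add: W_def)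
  have "real s \<le> 513 * W" using s_le W[OF e2] by linarith
  moreover have "real m \<le> 9234 * W" using m_le W[OF order_refl] by linarith
  moreover have "real m * k \<le> 9234 * W"
  proof -
    have "real m * k \<le> 9234 * (real l / \<epsilon> ^ 3) * (1 * k)"
      using mult_right_mono[OF m_le, of "real k"] by simp
    also have "\<dots> \<le> 9234 * (real l / \<epsilon> ^ 3) * (n * k)"
      using pos e1 by (intro mult_left_mono mult_right_mono) auto
    finally show ?thesis by (simp add: W_def mult_ac)
  qed
  moreover have "real n * k * s \<le> 513 * W"
  proof -
    have "real n * k * s \<le> real n * k * (513 * (real l / \<epsilon> ^ 3))"
      using s_le e2 by (intro mult_left_mono) auto
    then show ?thesis by (simp add: W_def mult_ac)
  qed
  moreover have "real n * k \<le> W" using mult_left_mono[OF e1, of "real n * k"] by (simp add: W_def)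
  moreover have "real n * 1 \<le> real n * k" using pos by (intro mult_left_mono) auto
  moreover have "real (query_max_ag_time n k l s m) = 5 * l + 3 * real s + 28 * real m + 5 * (real m * k)
      + 13 * (real n * k * s) + 14 * (real n * k) + 14 * real n + 13"
    by (simp add: query_max_ag_time_def algebra_simps)
  \<comment> \<open>The coefficients of \<open>W\<close> add up to 312976, most of it from the 28
    steps per sample point that do not scale with \<open>k\<close>.\<close>
  ultimately have "real (query_max_ag_time n k l s m) \<le> 400000 * W" using W[OF e0] W[OF e1] by linarith
  also have "\<dots> = 400000 * (real n * real k / \<epsilon> ^ 3) * l" by (simp add: W_def)
  also have "\<dots> \<le> 400000 * (real n * real k / \<epsilon> ^ 3) * (18 * ln (real k / (\<epsilon> ^ 2 * \<delta>)))"
    using l_le pos by (intro mult_left_mono) auto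
  finally show ?thesis by simp
qed

end

end

theorem theorem7:
  "\<exists>(QueryMaxAg :: com) (C :: real). C > 0 \<and>
     (\<forall>(\<epsilon> :: real) (\<delta> :: real) (k :: nat) (n :: nat) (L :: labelling) (D :: nat set set).
        \<epsilon> > 0 \<and> \<delta> > 0 \<and> k \<ge> 1 \<and> n \<ge> 1 \<and> optimal_clustering n k L D \<longrightarrow>
        (\<exists>T :: nat.
           (\<forall>cs \<in> set_pmf (execution QueryMaxAg \<epsilon> \<delta> k n L D T). halted cs) \<and>
           measure_pmf.prob (execution QueryMaxAg \<epsilon> \<delta> k n L D T)
             {cs. clustering n k (out_clustering n cs) \<and>
                  real (agreements n L (out_clustering n cs)) \<ge> real (OPT n k L) - \<epsilon> * real n ^ 2 / 2}
             \<ge> 1 - \<delta> \<and>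
           (\<epsilon> \<le> 1 \<and> real k / (\<epsilon> ^ 2 * \<delta>) \<ge> 2 \<longrightarrow>
              real T \<le> C * (real n * real k / \<epsilon> ^ 3 * ln (real k / (\<epsilon> ^ 2 * \<delta>))) \<and>
              (\<forall>cs \<in> set_pmf (execution QueryMaxAg \<epsilon> \<delta> k n L D T).
                 real (queries (snd cs)) \<le> C * (real k / \<epsilon> ^ 3 * ln (real k / (\<epsilon> ^ 2 * \<delta>)))))))"
proof (intro exI conjI allI impI)
  show "(7200000 :: real) > 0" by simp
next
  fix \<epsilon> \<delta> :: real and k n :: nat and L :: labelling and D :: "nat set set"
  assume asm: "\<epsilon> > 0 \<and> \<delta> > 0 \<and> k \<ge> 1 \<and> n \<ge> 1 \<and> optimal_clustering n k L D"
  define l where "l = log_size (64 * real k / (\<epsilon> * \<delta>))"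
  define s where "s = sample_size \<epsilon> l"
  define m where "m = sample_number \<epsilon> s"
  let ?T = "query_max_ag_time n k l s m"
  interpret instance_parameters \<epsilon> \<delta> k n L D l s m
    by unfold_locales (use asm in \<open>simp_all add: l_def s_def m_def\<close>)
  obtain M where M: "halts_with query_max_ag (init_store \<epsilon> \<delta> k n) ?T M"
    "\<forall>st\<in>set_pmf M. queries st \<le> m * k"
    "1 - \<delta> \<le> measure_pmf.prob M {st. good_output \<epsilon> k n L (out_clustering n (Skip, st))}"
    by (rule query_max_ag_result)
  have "(\<lambda>u v. {u, v} \<in> edges n \<and> L {u, v}) = edge_label n L"
    by (simp add: fun_eq_iff edge_label_def)
  then have exec: "execution query_max_ag \<epsilon> \<delta> k n L D ?T = map_pmf (Pair Skip) M"
    using M(1) by (simp add: execution_def halts_with_def)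
  show "\<forall>cs \<in> set_pmf (execution query_max_ag \<epsilon> \<delta> k n L D ?T). halted cs"
    by (auto simp: exec halted_def)
  show "measure_pmf.prob (execution query_max_ag \<epsilon> \<delta> k n L D ?T)
      {cs. clustering n k (out_clustering n cs) \<and>
           real (agreements n L (out_clustering n cs)) \<ge> real (OPT n k L) - \<epsilon> * real n ^ 2 / 2} \<ge> 1 - \<delta>"
    using M(3) by (simp add: exec good_output_def vimage_def)
  assume small: "\<epsilon> \<le> 1 \<and> real k / (\<epsilon> ^ 2 * \<delta>) \<ge> 2"
  show "real ?T \<le> 7200000 * (real n * real k / \<epsilon> ^ 3 * ln (real k / (\<epsilon> ^ 2 * \<delta>)))"
    using time_le small by blast
  show "\<forall>cs \<in> set_pmf (execution query_max_ag \<epsilon> \<delta> k n L D ?T).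
      real (queries (snd cs)) \<le> 7200000 * (real k / \<epsilon> ^ 3 * ln (real k / (\<epsilon> ^ 2 * \<delta>)))"
  proof
    fix cs assume "cs \<in> set_pmf (execution query_max_ag \<epsilon> \<delta> k n L D ?T)"
    then have "queries (snd cs) \<le> m * k" using M(2) by (auto simp: exec)
    then have "real (queries (snd cs)) \<le> real (m * k)" by (simp only: of_nat_le_iff)
    also have "\<dots> \<le> 7200000 * (real k / \<epsilon> ^ 3 * ln (real k / (\<epsilon> ^ 2 * \<delta>)))"
      using queries_le small by blast
    finally show "real (queries (snd cs)) \<le> 7200000 * (real k / \<epsilon> ^ 3 * ln (real k / (\<epsilon> ^ 2 * \<delta>)))" .
  qed
qed

end
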